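(* For all positive integers $m$ and $p$, $$(-1)^m \sum_{j=1}^p W(2j+2m-3,2m-1)\,Z(j,p)=(-1)^p \sum_{j=1}^m W(2j+2p-3,2p-1)\,Z(j,m).$$
   Context: For positive integers $k_1,\dots,k_r$ the alternating multiple $T$-value is $\bar T(k_1,\ldots,k_r):=2^r\sum_{0<n_1<\cdots<n_r}\frac{(-1)^{n_r}}{(2n_1-1)^{k_1}(2n_2-2)^{k_2}\cdots(2n_r-r)^{k_r}}$ (conditionally convergent series), with $\bar T(\emptyset):=1$. $I(k,r)$ denotes the set of tuples $(k_1,\dots,k_r)$ of positive integers with $k_1+\cdots+k_r=k$. $W(k,r):=\sum_{(k_1,\dots,k_r)\in I(k,r)}\bar T(k_1,\dots,k_r)$. $\bar\zeta(s):=\sum_{n\ge1}(-1)^{n-1}n^{-s}$ for integers $s\ge1$, and $\bar\zeta(0):=1/2$. For integers $1\le j\le p$: $Z(p,p):=1$ and, for $j<p$, $Z(j,p):=\sum_{k=1}^{p-j}(-2)^k\sum_{j=i_0<i_1<\cdots<i_{k-1}<i_k=p}\ \prod_{l=1}^k\bar\zeta(2i_l-2i_{l-1})$. *)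

theory Defs
  imports Complex_Main
begin

definition T_index :: "nat \<Rightarrow> nat \<Rightarrow> nat list set" where
  "T_index r N = {ns. length ns = r \<and> sorted_wrt (<) ns \<and> (\<forall>x\<in>set ns. 0 < x \<and> x \<le> N)}"

definition Tbar_partial :: "nat list \<Rightarrow> nat \<Rightarrow> real" where
  "Tbar_partial ks N =
     (\<Sum>ns\<in>T_index (length ks) N.
        (-1) ^ (last ns) *
        (\<Prod>i<length ks. 1 / (2 * real (ns ! i) - real (i + 1)) ^ (ks ! i)))"

text \<open>Alternating multiple T-value; the conditionally convergent series is summed
  in the natural order, i.e. as the limit of the partial sums over n_r <= N.\<close>
definition Tbar :: "nat list \<Rightarrow> real" where
  "Tbar ks = (if ks = [] then 1
              else 2 ^ length ks * lim (\<lambda>N. Tbar_partial ks N))"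

definition Icomp :: "nat \<Rightarrow> nat \<Rightarrow> nat list set" where
  "Icomp k r = {ks. length ks = r \<and> (\<forall>x\<in>set ks. 0 < x) \<and> sum_list ks = k}"

definition W :: "nat \<Rightarrow> nat \<Rightarrow> real" where
  "W k r = (\<Sum>ks\<in>Icomp k r. Tbar ks)"

definition zetabar :: "nat \<Rightarrow> real" where
  "zetabar s = (if s = 0 then 1 / 2
                else (\<Sum>n. (-1) ^ n / (real (n + 1)) ^ s))"

definition chains :: "nat \<Rightarrow> nat \<Rightarrow> nat \<Rightarrow> nat list set" where
  "chains j p k = {is. length is = k + 1 \<and> sorted_wrt (<) is \<and> set is \<subseteq> {j..p}
                       \<and> is ! 0 = j \<and> is ! k = p}"

definition Z :: "nat \<Rightarrow> nat \<Rightarrow> real" where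
  "Z j p = (if j = p then 1
            else (\<Sum>k=1..p-j. (-2) ^ k *
                    (\<Sum>is\<in>chains j p k.
                       \<Prod>l=1..k. zetabar (2 * (is ! l) - 2 * (is ! (l - 1))))))"

end

theory Submission
  imports Defs "HOL-Analysis.Analysis" "HOL-Real_Asymp.Real_Asymp"
begin

text \<open>
  Write \<open>gd v = arctan (sinh v)\<close>. Summing the defining series against \<open>exp (- (2 n\<^sub>r - r) z)\<close> gives
  functions of \<open>z\<close> that satisfy a first order recursion in weight and depth, whose solution at
  \<open>z = 0\<close> is
  \[ (-1)^r W(r + d, r) = \int_0^\infty \frac{v^d}{d!} \frac{(gd\, v)^{r-1}}{(r-1)!} \frac{dv}{\cosh v}. \]
  The numbers \<open>Z j p\<close> are the coefficients of the reciprocal of the power series with coefficients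
  \<open>c\<^sub>0 = 1\<close>, \<open>c\<^sub>n = 2 \<zeta>bar (2 n)\<close>, so the claim is equivalent to the symmetry in \<open>m\<close> and \<open>j\<close> of
  \[ \sum_{i \le m} c_{m-i} (-1)^i \int_0^\infty \frac{v^{2j}}{(2j)!} \frac{(gd\, v)^{2i}}{(2i)!} \frac{dv}{\cosh v}. \]
  The polynomial \<open>\<Sum>i\<le>m. c\<^sub>m\<^sub>-\<^sub>i (-1)\<^sup>i \<alpha>\<^sup>2\<^sup>i / (2 i)!\<close> is the moment of order \<open>2 m\<close> of
  \<open>Re (1 / (1 + cosh (u - \<i> \<alpha>)))\<close>, \<open>u \<ge> 0\<close>, and for \<open>\<alpha> = gd v\<close> this kernel divided by \<open>cosh v\<close> equals
  \<open>(cosh u + cosh v) / (1 + cosh u cosh v)\<^sup>2\<close>. The expression is therefore a double integral with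
  a symmetric kernel.
\<close>

section \<open>The Gudermannian and iterated integrals\<close>

lemma borel_measurable_cosh [measurable]: "(cosh :: real \<Rightarrow> real) \<in> borel_measurable borel"
  by (intro borel_measurable_continuous_onI continuous_intros)

lemma borel_measurable_sinh [measurable]: "(sinh :: real \<Rightarrow> real) \<in> borel_measurable borel"
  by (intro borel_measurable_continuous_onI continuous_intros)

definition gd :: "real \<Rightarrow> real" where
  "gd v = arctan (sinh v)"

lemma borel_measurable_gd [measurable]: "gd \<in> borel_measurable borel"
  unfolding gd_def by measurable

lemma DERIV_gd [THEN DERIV_chain2, derivative_intros]:
  "(gd has_real_derivative 1 / cosh v) (at v)"
proof -
  have "1 + (sinh v)\<^sup>2 = (cosh v)\<^sup>2"
    by (simp add: cosh_square_eq)
  then show ?thesis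
    unfolding gd_def by (auto intro!: derivative_eq_intros simp: power2_eq_square field_simps)
qed

lemma cos_gd: "cos (gd v) = 1 / cosh v"
proof -
  have "1 + (sinh v)\<^sup>2 = (cosh v)\<^sup>2"
    by (simp add: cosh_square_eq)
  then show ?thesis
    unfolding gd_def cos_arctan by simp
qed

lemma gd_nonneg: "0 \<le> v \<Longrightarrow> 0 \<le> gd v"
  by (simp add: gd_def)

lemma gd_less_pi_half: "gd v < pi / 2"
  unfolding gd_def by (rule arctan_ubound)

lemma gd_mono: "u \<le> v \<Longrightarrow> gd u \<le> gd v"
  by (simp add: gd_def arctan_le_iff)

lemma gd_0 [simp]: "gd 0 = 0"
  by (simp add: gd_def)

section \<open>Tonelli's theorem on triangles and rectangles, and integrals over half lines\<close>

lemma nn_integral_triangle: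
  fixes f :: "real \<Rightarrow> real \<Rightarrow> ennreal"
  assumes [measurable]: "case_prod f \<in> borel_measurable (borel \<Otimes>\<^sub>M borel)"
  shows "(\<integral>\<^sup>+y\<in>{z..}. (\<integral>\<^sup>+v\<in>{y..}. f y v \<partial>lborel) \<partial>lborel)
       = (\<integral>\<^sup>+v\<in>{z..}. (\<integral>\<^sup>+y\<in>{z..v}. f y v \<partial>lborel) \<partial>lborel)"
proof -
  have "(\<integral>\<^sup>+y\<in>{z..}. (\<integral>\<^sup>+v\<in>{y..}. f y v \<partial>lborel) \<partial>lborel)
      = (\<integral>\<^sup>+y. (\<integral>\<^sup>+v. f y v * (if z \<le> y \<and> y \<le> v then 1 else 0) \<partial>lborel) \<partial>lborel)"
    by (subst nn_integral_multc[symmetric])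
       (auto intro!: nn_integral_cong simp: indicator_def)
  also have "\<dots> = (\<integral>\<^sup>+v. (\<integral>\<^sup>+y. f y v * (if z \<le> y \<and> y \<le> v then 1 else 0) \<partial>lborel) \<partial>lborel)"
    by (rule lborel_pair.Fubini'[symmetric]) measurable
  also have "\<dots> = (\<integral>\<^sup>+v\<in>{z..}. (\<integral>\<^sup>+y\<in>{z..v}. f y v \<partial>lborel) \<partial>lborel)"
    by (subst nn_integral_multc[symmetric])
       (auto intro!: nn_integral_cong simp: indicator_def)
  finally show ?thesis .
qed

lemma nn_integral_rectangle:
  fixes f :: "real \<Rightarrow> real \<Rightarrow> ennreal"
  assumes [measurable]: "case_prod f \<in> borel_measurable (borel \<Otimes>\<^sub>M borel)"
    "A \<in> sets borel" "B \<in> sets borel"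
  shows "(\<integral>\<^sup>+y\<in>A. (\<integral>\<^sup>+v\<in>B. f y v \<partial>lborel) \<partial>lborel)
       = (\<integral>\<^sup>+v\<in>B. (\<integral>\<^sup>+y\<in>A. f y v \<partial>lborel) \<partial>lborel)"
proof -
  have "(\<integral>\<^sup>+y\<in>A. (\<integral>\<^sup>+v\<in>B. f y v \<partial>lborel) \<partial>lborel)
      = (\<integral>\<^sup>+y. (\<integral>\<^sup>+v. f y v * indicator B v * indicator A y \<partial>lborel) \<partial>lborel)"
    by (subst nn_integral_multc[symmetric]) auto
  also have "\<dots> = (\<integral>\<^sup>+v. (\<integral>\<^sup>+y. f y v * indicator B v * indicator A y \<partial>lborel) \<partial>lborel)"
    by (rule lborel_pair.Fubini'[symmetric]) measurable
  also have "\<dots> = (\<integral>\<^sup>+v\<in>B. (\<integral>\<^sup>+y\<in>A. f y v \<partial>lborel) \<partial>lborel)"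
    by (subst nn_integral_multc[symmetric])
       (auto intro!: nn_integral_cong simp: mult_ac)
  finally show ?thesis .
qed

text \<open>\<open>- F\<close> is an antiderivative of \<open>f\<close> with limit 0 at infinity,
  and \<open>F\<close> decreases to that limit. Both conclusions are needed, since
  \<open>ennreal\<close> sends every negative real to 0 and the first one alone would not determine
  \<open>F a\<close>.\<close>

lemma
  fixes F f :: "real \<Rightarrow> real"
  assumes [measurable]: "f \<in> borel_measurable borel"
    and "\<And>x. a \<le> x \<Longrightarrow> (F has_real_derivative - f x) (at x)"
    and "\<And>x. a \<le> x \<Longrightarrow> 0 \<le> f x"
    and "(F \<longlongrightarrow> 0) at_top"
  shows nn_integral_tail: "(\<integral>\<^sup>+x\<in>{a..}. f x \<partial>lborel) = ennreal (F a)"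
    and tail_nonneg: "0 \<le> F a"
proof -
  have "(\<integral>\<^sup>+x\<in>{a..}. f x \<partial>lborel) = ennreal (0 - (- F a))"
    by (rule nn_integral_FTC_atLeast)
       (use assms in \<open>auto intro!: derivative_eq_intros tendsto_eq_intros\<close>)
  then show "(\<integral>\<^sup>+x\<in>{a..}. f x \<partial>lborel) = ennreal (F a)" by simp
  have "F x \<le> F a" if "a \<le> x" for x
    using that assms(2,3) by (intro DERIV_nonpos_imp_nonincreasing[of a x F]) fastforce+
  then show "0 \<le> F a"
    by (intro tendsto_upperbound[OF assms(4)] eventually_at_top_linorderI[of a]) auto
qed

section \<open>Moments on the half line, normalised by factorials\<close>

definition mom :: "nat \<Rightarrow> (real \<Rightarrow> ennreal) \<Rightarrow> ennreal" where
  "mom n g = (\<integral>\<^sup>+v\<in>{0..}. ennreal (v ^ n / fact n) * g v \<partial>lborel)"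

lemma mom_cong: "(\<And>v. 0 \<le> v \<Longrightarrow> f v = g v) \<Longrightarrow> mom n f = mom n g"
  unfolding mom_def by (rule nn_integral_cong) (auto simp: indicator_def)

lemma DERIV_divided_power:
  "((\<lambda>x. x ^ Suc n / fact (Suc n)) has_real_derivative x ^ n / fact n) (at x)"
proof -
  have "((\<lambda>x. x ^ Suc n / fact (Suc n)) has_real_derivative
      real (Suc n) * x ^ n / (real (Suc n) * fact n)) (at x)"
    using DERIV_cdivide[OF DERIV_pow[of "Suc n" x], of "fact (Suc n)"] by simp
  then show ?thesis by (simp del: of_nat_Suc)
qed

lemma nn_integral_monomial:
  assumes "0 \<le> (v::real)"
  shows "(\<integral>\<^sup>+s\<in>{0..v}. ennreal (s ^ n / fact n) \<partial>lborel) = ennreal (v ^ Suc n / fact (Suc n))"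
proof -
  have "(\<integral>\<^sup>+s\<in>{0..v}. ennreal (s ^ n / fact n) \<partial>lborel)
      = ennreal (v ^ Suc n / fact (Suc n) - 0 ^ Suc n / fact (Suc n))"
  proof (rule nn_integral_FTC_Icc)
    show "((\<lambda>x. x ^ Suc n / fact (Suc n)) has_real_derivative x ^ n / fact n) (at x)" for x :: real
      by (rule DERIV_divided_power)
  qed (use assms in auto)
  then show ?thesis by simp
qed

text \<open>Integration by parts without boundary terms: \<open>v ^ Suc n / fact (Suc n)\<close> is
  the integral of \<open>s ^ n / fact n\<close> over 0 \<le> s \<le> v, and the order of integration
  over this triangle is exchanged. The factorials keep the identity free of constants.\<close>

lemma mom_Suc:
  assumes [measurable]: "g \<in> borel_measurable borel"
  shows "mom (Suc n) g = mom n (\<lambda>s. \<integral>\<^sup>+v\<in>{s..}. g v \<partial>lborel)"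
proof -
  have "mom (Suc n) g
      = (\<integral>\<^sup>+v\<in>{0..}. (\<integral>\<^sup>+s\<in>{0..v}. ennreal (s ^ n / fact n) * g v \<partial>lborel) \<partial>lborel)"
    unfolding mom_def
  proof (rule nn_integral_cong)
    fix v :: real
    have "(\<integral>\<^sup>+s\<in>{0..v}. ennreal (s ^ n / fact n) * g v \<partial>lborel)
        = (\<integral>\<^sup>+s\<in>{0..v}. ennreal (s ^ n / fact n) \<partial>lborel) * g v"
      by (subst nn_integral_multc[symmetric]) (auto intro!: nn_integral_cong simp: mult_ac)
    then show "ennreal (v ^ Suc n / fact (Suc n)) * g v * indicator {0..} v
        = (\<integral>\<^sup>+s\<in>{0..v}. ennreal (s ^ n / fact n) * g v \<partial>lborel) * indicator {0..} v"
      using nn_integral_monomial[of v n] by (auto simp: indicator_def)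
  qed
  also have "\<dots> = (\<integral>\<^sup>+s\<in>{0..}. (\<integral>\<^sup>+v\<in>{s..}. ennreal (s ^ n / fact n) * g v \<partial>lborel) \<partial>lborel)"
    by (rule nn_integral_triangle[symmetric]) measurable
  also have "\<dots> = mom n (\<lambda>s. \<integral>\<^sup>+v\<in>{s..}. g v \<partial>lborel)"
    unfolding mom_def
    by (subst nn_integral_cmult[symmetric]) (auto intro!: nn_integral_cong simp: mult_ac)
  finally show ?thesis .
qed

lemma mom_nn_integral:
  fixes f :: "real \<Rightarrow> real \<Rightarrow> ennreal"
  assumes [measurable]: "case_prod f \<in> borel_measurable (borel \<Otimes>\<^sub>M borel)" "A \<in> sets borel"
  shows "mom n (\<lambda>v. \<integral>\<^sup>+y\<in>A. f y v \<partial>lborel) = (\<integral>\<^sup>+y\<in>A. mom n (f y) \<partial>lborel)"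
proof -
  have "mom n (\<lambda>v. \<integral>\<^sup>+y\<in>A. f y v \<partial>lborel)
      = (\<integral>\<^sup>+v\<in>{0..}. (\<integral>\<^sup>+y\<in>A. ennreal (v ^ n / fact n) * f y v \<partial>lborel) \<partial>lborel)"
    unfolding mom_def
    by (subst nn_integral_cmult[symmetric]) (auto intro!: nn_integral_cong simp: mult_ac)
  also have "\<dots> = (\<integral>\<^sup>+y\<in>A. mom n (f y) \<partial>lborel)"
    unfolding mom_def
    by (rule nn_integral_rectangle[where f = "\<lambda>v y. ennreal (v ^ n / fact n) * f y v"]) measurable
  finally show ?thesis .
qed

lemma mom_add:
  assumes [measurable]: "f \<in> borel_measurable borel" "g \<in> borel_measurable borel"
  shows "mom n (\<lambda>v. f v + g v) = mom n f + mom n g"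
  unfolding mom_def by (simp add: distrib_left distrib_right nn_integral_add)

lemma mom_cmult:
  assumes [measurable]: "f \<in> borel_measurable borel"
  shows "mom n (\<lambda>v. c * f v) = c * mom n f"
  unfolding mom_def by (subst nn_integral_cmult[symmetric]) (auto simp: mult_ac)

text \<open>The tail integral of the exponential is \<open>1 / c\<close> times the exponential
  itself, so each use of \<open>mom_Suc\<close> contributes one factor \<open>1 / c\<close>.\<close>

lemma mom_exp:
  assumes "0 < c"
  shows "mom n (\<lambda>v. ennreal (exp (- c * v))) = ennreal (1 / c ^ Suc n)"
proof -
  have tail: "(\<integral>\<^sup>+v\<in>{s..}. ennreal (exp (- c * v)) \<partial>lborel) = ennreal (1 / c) * ennreal (exp (- c * s))" for s
  proof -
    have "(\<integral>\<^sup>+v\<in>{s..}. ennreal (exp (- c * v)) \<partial>lborel) = ennreal (exp (- c * s) / c)"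
      by (rule nn_integral_tail[where F = "\<lambda>s. exp (- c * s) / c"])
         (use assms in \<open>auto intro!: derivative_eq_intros, real_asymp\<close>)
    then show ?thesis using assms by (simp flip: ennreal_mult)
  qed
  show ?thesis
  proof (induction n)
    case 0
    show ?case using tail[of 0] unfolding mom_def by simp
  next
    case (Suc n)
    have "mom (Suc n) (\<lambda>v. ennreal (exp (- c * v)))
        = ennreal (1 / c) * mom n (\<lambda>v. ennreal (exp (- c * v)))"
      by (subst mom_Suc, measurable, unfold tail, subst mom_cmult, measurable)
    then show ?case using assms Suc by (simp flip: ennreal_mult)
  qed
qed

section \<open>Moments of the kernel\<close>

text \<open>The real part of \<open>1 / (1 + cosh (v - \<i> * \<alpha>))\<close>; the identities below are the
  Cauchy-Riemann equations for its primitive \<open>tanh ((v - \<i> * \<alpha>) / 2)\<close>.\<close>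
definition gker :: "real \<Rightarrow> real \<Rightarrow> real" where
  "gker \<alpha> v = (1 + cos \<alpha> * cosh v) / (cosh v + cos \<alpha>)\<^sup>2"

lemma borel_measurable_gker [measurable (raw)]:
  assumes [measurable]: "f \<in> borel_measurable M" "g \<in> borel_measurable M"
  shows "(\<lambda>x. gker (f x) (g x)) \<in> borel_measurable M"
  unfolding gker_def by measurable

lemma gker_nonneg: "0 \<le> cos \<alpha> \<Longrightarrow> 0 \<le> gker \<alpha> v"
  unfolding gker_def by (intro divide_nonneg_nonneg add_nonneg_nonneg mult_nonneg_nonneg) auto

text \<open>The substitution \<open>cos (gd v) = 1 / cosh v\<close> makes the kernel rational in
  \<open>cosh u\<close> and \<open>cosh v\<close>. The symmetry of the right side in
  \<open>u\<close> and \<open>v\<close> is the source of the symmetry of the theorem.\<close>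

lemma gker_gd: "gker (gd v) u / cosh v = (cosh u + cosh v) / (1 + cosh u * cosh v)\<^sup>2"
proof -
  define A B where "A = cosh u" and "B = cosh v"
  have "A > 0" "B > 0" by (auto simp: A_def B_def)
  then have "1 + A * B \<noteq> 0" "A + 1 / B \<noteq> 0" 
    by (smt (verit) mult_pos_pos divide_pos_pos)+
  moreover have "(A + 1 / B)\<^sup>2 * B\<^sup>2 = (1 + A * B)\<^sup>2"
    using \<open>B > 0\<close> by (simp add: field_simps power2_eq_square)
  ultimately have "(1 + 1 / B * A) / (A + 1 / B)\<^sup>2 / B = (A + B) / (1 + A * B)\<^sup>2"
    using \<open>B > 0\<close> by (simp flip: \<open>(A + 1 / B)\<^sup>2 * B\<^sup>2 = (1 + A * B)\<^sup>2\<close>)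
      (simp add: divide_simps, simp add: power2_eq_square algebra_simps)
  then show ?thesis unfolding gker_def cos_gd A_def B_def .
qed

text \<open>\<open>sinh s / (cosh s + cos \<alpha>)\<close> is the real part of
  \<open>tanh ((s - \<i> * \<alpha>) / 2)\<close>, which tends to 1.\<close>

lemma gker_tail:
  assumes "0 \<le> cos \<alpha>"
  shows "(\<integral>\<^sup>+v\<in>{s..}. gker \<alpha> v \<partial>lborel) = ennreal (1 - sinh s / (cosh s + cos \<alpha>))"
proof (rule nn_integral_tail[where F = "\<lambda>s. 1 - sinh s / (cosh s + cos \<alpha>)"])
  fix x :: real
  have "cosh x + cos \<alpha> > 0" using assms cosh_real_pos[of x] by linarith
  then have "((\<lambda>s. 1 - sinh s / (cosh s + cos \<alpha>)) has_real_derivative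
      - ((cosh x * (cosh x + cos \<alpha>) - sinh x * sinh x) / ((cosh x + cos \<alpha>) * (cosh x + cos \<alpha>)))) (at x)"
    by (auto intro!: derivative_eq_intros)
  moreover have "cosh x * (cosh x + cos \<alpha>) - sinh x * sinh x = 1 + cos \<alpha> * cosh x"
    using hyperbolic_pythagoras[of x] by (simp add: power2_eq_square algebra_simps)
  ultimately show "((\<lambda>s. 1 - sinh s / (cosh s + cos \<alpha>)) has_real_derivative - gker \<alpha> x) (at x)"
    by (simp add: gker_def power2_eq_square)
next
  show "((\<lambda>s. 1 - sinh s / (cosh s + cos \<alpha>)) \<longlongrightarrow> 0) at_top"
    unfolding sinh_field_def cosh_field_def by real_asymp
qed (use assms in \<open>auto intro: gker_nonneg\<close>)

text \<open>The imaginary part of \<open>1 / (1 + cosh (v - \<i> * \<alpha>))\<close>.\<close>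

definition gcross :: "real \<Rightarrow> real \<Rightarrow> real" where
  "gcross \<alpha> v = sinh v * sin \<alpha> / (cosh v + cos \<alpha>)\<^sup>2"

lemma borel_measurable_gcross [measurable (raw)]:
  assumes [measurable]: "f \<in> borel_measurable M" "g \<in> borel_measurable M"
  shows "(\<lambda>x. gcross (f x) (g x)) \<in> borel_measurable M"
  unfolding gcross_def by measurable

lemma gcross_tail:
  assumes "0 \<le> cos \<alpha>" "0 \<le> sin \<alpha>" "0 \<le> s"
  shows "(\<integral>\<^sup>+v\<in>{s..}. gcross \<alpha> v \<partial>lborel) = ennreal (sin \<alpha> / (cosh s + cos \<alpha>))"
proof (rule nn_integral_tail[where F = "\<lambda>s. sin \<alpha> / (cosh s + cos \<alpha>)"])
  fix x :: real
  have "cosh x + cos \<alpha> > 0" using assms cosh_real_pos[of x] by linarith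
  then show "((\<lambda>s. sin \<alpha> / (cosh s + cos \<alpha>)) has_real_derivative - gcross \<alpha> x) (at x)"
    by (auto intro!: derivative_eq_intros simp: gcross_def power2_eq_square divide_simps)
next
  show "((\<lambda>s. sin \<alpha> / (cosh s + cos \<alpha>)) \<longlongrightarrow> 0) at_top"
    unfolding cosh_field_def by real_asymp
qed (use assms in \<open>auto simp: gcross_def\<close>)

text \<open>The value is that of \<open>gcross_tail\<close> at the angle \<beta>. This is one
  Cauchy-Riemann equation: a tail integral of \<open>gcross\<close> in \<open>v\<close> is traded
  for an integral of \<open>gker\<close> in the angle.\<close>

lemma gker_integral_angle:
  assumes "0 \<le> \<beta>" "\<beta> \<le> pi / 2"
  shows "(\<integral>\<^sup>+\<gamma>\<in>{0..\<beta>}. gker \<gamma> s \<partial>lborel) = ennreal (sin \<beta> / (cosh s + cos \<beta>))"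
proof -
  have "(\<integral>\<^sup>+\<gamma>\<in>{0..\<beta>}. gker \<gamma> s \<partial>lborel)
      = ennreal (sin \<beta> / (cosh s + cos \<beta>) - sin 0 / (cosh s + cos 0))"
  proof (rule nn_integral_FTC_Icc)
    fix x :: real assume x: "x \<in> {0..\<beta>}"
    then have c: "0 \<le> cos x" using assms by (intro cos_ge_zero) auto
    then show "0 \<le> gker x s" by (rule gker_nonneg)
    from c have "cosh s + cos x > 0" using cosh_real_pos[of s] by linarith
    then have "((\<lambda>x. sin x / (cosh s + cos x)) has_real_derivative gker x s) (at x)"
      by (auto intro!: derivative_eq_intros simp: gker_def power2_eq_square divide_simps)
         (use sin_cos_squared_add[of x] in \<open>simp add: power2_eq_square algebra_simps\<close>)
    then show "((\<lambda>x. sin x / (cosh s + cos x)) has_real_derivative gker x s) (at x)" .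
  qed (use assms in auto)
  then show ?thesis by simp
qed

text \<open>The other Cauchy-Riemann equation: the value is the difference between the tails of
  \<open>gker\<close> at the angles 0 and \<alpha>.\<close>

lemma gcross_integral_angle:
  assumes "0 \<le> \<alpha>" "\<alpha> \<le> pi / 2" "0 \<le> s"
  shows "(\<integral>\<^sup>+\<beta>\<in>{0..\<alpha>}. gcross \<beta> s \<partial>lborel)
       = ennreal (sinh s / (cosh s + cos \<alpha>) - sinh s / (cosh s + 1))"
proof -
  have "(\<integral>\<^sup>+\<beta>\<in>{0..\<alpha>}. gcross \<beta> s \<partial>lborel)
       = ennreal (sinh s / (cosh s + cos \<alpha>) - sinh s / (cosh s + cos 0))"
  proof (rule nn_integral_FTC_Icc)
    fix x :: real assume x: "x \<in> {0..\<alpha>}"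
    then have c: "0 \<le> cos x" "0 \<le> sin x"
      using assms by (auto intro: cos_ge_zero sin_ge_zero)
    then show "0 \<le> gcross x s" using assms by (simp add: gcross_def)
    from c have "cosh s + cos x > 0" using cosh_real_pos[of s] by linarith
    then show "((\<lambda>x. sinh s / (cosh s + cos x)) has_real_derivative gcross x s) (at x)"
      by (auto intro!: derivative_eq_intros simp: gcross_def power2_eq_square divide_simps)
  qed (use assms in auto)
  then show ?thesis by simp
qed

definition gmom :: "nat \<Rightarrow> real \<Rightarrow> ennreal" where
  "gmom m \<alpha> = mom (2 * m) (\<lambda>v. ennreal (gker \<alpha> v))"

lemma gmom_0:
  assumes "0 \<le> cos \<alpha>"
  shows "gmom 0 \<alpha> = 1"
  using gker_tail[OF assms, of 0] unfolding gmom_def mom_def by simp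

lemma gmom_Suc_eq:
  assumes "0 \<le> cos \<alpha>"
  shows "gmom (Suc m) \<alpha> = mom (2 * m + 1) (\<lambda>s. ennreal (1 - sinh s / (cosh s + cos \<alpha>)))"
  unfolding gmom_def using mom_Suc[of "\<lambda>v. ennreal (gker \<alpha> v)" "2 * m + 1"]
  by (simp add: gker_tail[OF assms])

text \<open>The integrated form of \<open>gmom (Suc m)'' = - gmom m\<close>.\<close>
lemma gmom_Suc:
  assumes "0 \<le> \<alpha>" "\<alpha> \<le> pi / 2"
  shows "gmom (Suc m) \<alpha> + (\<integral>\<^sup>+\<beta>\<in>{0..\<alpha>}. (\<integral>\<^sup>+\<gamma>\<in>{0..\<beta>}. gmom m \<gamma> \<partial>lborel) \<partial>lborel)
       = gmom (Suc m) 0"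
proof -
  have c: "0 \<le> cos \<beta>" "0 \<le> sin \<beta>" if "\<beta> \<in> {0..\<alpha>}" for \<beta>
    using assms that by (auto intro: cos_ge_zero sin_ge_zero)
  \<comment> \<open>\<open>mom_Suc\<close> lowers the order by one and produces a tail of
    \<open>gcross\<close>, which is an angle integral of \<open>gker\<close>.\<close>
  have cross: "mom (2 * m + 1) (\<lambda>v. ennreal (gcross \<beta> v)) = (\<integral>\<^sup>+\<gamma>\<in>{0..\<beta>}. gmom m \<gamma> \<partial>lborel)"
    if \<beta>: "\<beta> \<in> {0..\<alpha>}" for \<beta>
  proof -
    have "mom (2 * m + 1) (\<lambda>v. ennreal (gcross \<beta> v))
        = mom (2 * m) (\<lambda>s. \<integral>\<^sup>+v\<in>{s..}. gcross \<beta> v \<partial>lborel)"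
      by (simp add: mom_Suc)
    also have "\<dots> = mom (2 * m) (\<lambda>s. \<integral>\<^sup>+\<gamma>\<in>{0..\<beta>}. gker \<gamma> s \<partial>lborel)"
      using \<beta> assms by (intro mom_cong) (simp add: gcross_tail c gker_integral_angle)
    also have "\<dots> = (\<integral>\<^sup>+\<gamma>\<in>{0..\<beta>}. gmom m \<gamma> \<partial>lborel)"
      unfolding gmom_def by (rule mom_nn_integral) measurable
    finally show ?thesis .
  qed
  have "gmom (Suc m) 0 = mom (2 * m + 1) (\<lambda>s. ennreal (1 - sinh s / (cosh s + cos \<alpha>))
          + (\<integral>\<^sup>+\<beta>\<in>{0..\<alpha>}. gcross \<beta> s \<partial>lborel))"
  proof (subst gmom_Suc_eq, simp, rule mom_cong)
    fix s :: real assume s: "0 \<le> s"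
    have c\<alpha>: "0 \<le> cos \<alpha>" "cos \<alpha> \<le> 1" using assms by (auto intro: cos_ge_zero)
    \<comment> \<open>The two inequalities make both summands nonnegative, as splitting
      \<open>ennreal\<close> of their sum requires.\<close>
    have "sinh s < cosh s" by (rule sinh_less_cosh_real)
    then have "sinh s / (cosh s + cos \<alpha>) \<le> 1" 
      using c\<alpha> cosh_real_pos[of s] by (subst divide_le_eq_1_pos) linarith+
    moreover have "sinh s / (cosh s + 1) \<le> sinh s / (cosh s + cos \<alpha>)"
      using c\<alpha> cosh_real_pos[of s] s by (intro divide_left_mono) (auto intro!: mult_pos_pos add_pos_nonneg)
    ultimately show "ennreal (1 - sinh s / (cosh s + cos 0))
        = ennreal (1 - sinh s / (cosh s + cos \<alpha>)) + (\<integral>\<^sup>+\<beta>\<in>{0..\<alpha>}. gcross \<beta> s \<partial>lborel)"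
      using assms s by (simp add: gcross_integral_angle flip: ennreal_plus)
  qed
  also have "\<dots> = gmom (Suc m) \<alpha> + mom (2 * m + 1) (\<lambda>s. \<integral>\<^sup>+\<beta>\<in>{0..\<alpha>}. gcross \<beta> s \<partial>lborel)"
    using assms by (subst mom_add) (auto simp: gmom_Suc_eq c)
  also have "mom (2 * m + 1) (\<lambda>s. \<integral>\<^sup>+\<beta>\<in>{0..\<alpha>}. gcross \<beta> s \<partial>lborel)
      = (\<integral>\<^sup>+\<beta>\<in>{0..\<alpha>}. mom (2 * m + 1) (\<lambda>s. ennreal (gcross \<beta> s)) \<partial>lborel)"
    by (rule mom_nn_integral) measurable
  also have "\<dots> = (\<integral>\<^sup>+\<beta>\<in>{0..\<alpha>}. (\<integral>\<^sup>+\<gamma>\<in>{0..\<beta>}. gmom m \<gamma> \<partial>lborel) \<partial>lborel)"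
    by (rule nn_integral_cong) (use cross in \<open>auto simp: indicator_def\<close>)
  finally show ?thesis by simp
qed

section \<open>Moments at angle zero: the alternating zeta values\<close>

definition zcoef :: "nat \<Rightarrow> real" where
  "zcoef n = 2 * zetabar (2 * n)"

lemma zcoef_0 [simp]: "zcoef 0 = 1"
  by (simp add: zcoef_def zetabar_def)

text \<open>The expansion of \<open>1 / (exp s + 1)\<close> in powers of \<open>exp (- s)\<close>
  alternates in sign. Consecutive terms are paired so that all terms are nonnegative and the series
  can be integrated term by term by monotone convergence.\<close>

lemma fermi_suminf:
  assumes "0 < (s::real)"
  shows "(\<lambda>i. exp (- real (2*i+1) * s) - exp (- real (2*i+2) * s)) sums (1 / (exp s + 1))"
proof -
  define t where "t = exp (- s)"
  have t: "0 < t" "t < 1" using assms by (auto simp: t_def)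
  have "(\<lambda>i. (t - t\<^sup>2) * (t\<^sup>2) ^ i) sums ((t - t\<^sup>2) * (1 / (1 - t\<^sup>2)))"
    using t by (intro sums_mult geometric_sums) (auto simp: power_less_one_iff)
  moreover have "(t - t\<^sup>2) * (t\<^sup>2) ^ i = exp (- real (2*i+1) * s) - exp (- real (2*i+2) * s)" for i
  proof -
    have "exp (- real n * s) = t ^ n" for n
      unfolding t_def by (simp flip: exp_of_nat_mult)
    then have "exp (- real (2*i+1) * s) - exp (- real (2*i+2) * s) = t ^ (2*i+1) - t ^ (2*i+2)"
      by (simp only:)
    also have "\<dots> = (t - t\<^sup>2) * (t\<^sup>2) ^ i"
      by (simp add: power_mult power_add algebra_simps power2_eq_square)
    finally show ?thesis by simp
  qed
  moreover have "(t - t\<^sup>2) * (1 / (1 - t\<^sup>2)) = 1 / (exp s + 1)"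
  proof -
    have "1 - t\<^sup>2 = (1 - t) * (1 + t)" by (simp add: power2_eq_square algebra_simps)
    moreover have "t * exp s = 1" by (simp add: t_def exp_minus)
    then have "t * (exp s + 1) = 1 + t" by (simp add: algebra_simps)
    moreover have "exp s + 1 \<noteq> 0" using exp_gt_zero[of s] by linarith
    moreover have "1 - t\<^sup>2 \<noteq> 0"
      using t by (simp add: \<open>1 - t\<^sup>2 = (1 - t) * (1 + t)\<close>)
    ultimately show ?thesis
      using t by (simp add: frac_eq_eq power2_eq_square) (simp add: algebra_simps)
  qed
  ultimately show ?thesis by simp
qed

text \<open>The tail of the kernel at angle 0 is \<open>1 - tanh (s / 2) = 2 / (exp s + 1)\<close>.
  Expanding it by \<open>fermi_suminf\<close> and integrating with \<open>mom_exp\<close> gives the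
  series of \<open>zetabar\<close>, summed in pairs.\<close>

lemma gmom_Suc_0: "gmom (Suc m) 0 = ennreal (zcoef (Suc m))" and zcoef_Suc_nonneg: "0 \<le> zcoef (Suc m)"
proof -
  define e where "e = (\<lambda>n::nat. 1 / real (n + 1) ^ (2 * m + 2))"
  have e0: "0 \<le> e n" for n by (simp add: e_def)
  have edec: "e (Suc n) \<le> e n" for n
    unfolding e_def by (intro divide_left_mono power_mono mult_pos_pos zero_less_power) auto
  have elim: "e \<longlonglongrightarrow> 0"
    unfolding e_def by real_asymp
  have "(\<lambda>n. (-1) ^ n * e n) sums zetabar (2 * Suc m)"
  proof -
    have "summable (\<lambda>n. (-1) ^ n * e n)"
      using elim edec by (intro summable_Leibniz(1) decseq_imp_monoseq decseq_SucI) auto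
    then show ?thesis
      by (simp add: zetabar_def e_def sums_iff)
  qed
  then have "(\<lambda>n. \<Sum>k\<in>{n*2..<n*2+2}. (-1) ^ k * e k) sums zetabar (2 * Suc m)"
    by (rule sums_group) auto
  then have pair: "(\<lambda>n. e (2*n) - e (2*n+1)) sums zetabar (2 * Suc m)"
    by (simp add: mult.commute atLeastLessThanSuc)
  have mom_pair: "mom (2*m+1) (\<lambda>s. ennreal (exp (- real (2*i+1) * s) - exp (- real (2*i+2) * s)))
      = ennreal (e (2*i) - e (2*i+1))" for i
  proof -
    \<comment> \<open>Moments are additive but not subtractive in \<open>ennreal\<close>, so the
      larger exponential is written as a sum and the finite moment of the smaller one is cancelled
      afterwards.\<close>
    have "mom (2*m+1) (\<lambda>s. ennreal (exp (- real (2*i+1) * s)))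
        = mom (2*m+1) (\<lambda>s. ennreal (exp (- real (2*i+1) * s) - exp (- real (2*i+2) * s))
            + ennreal (exp (- real (2*i+2) * s)))"
      by (rule mom_cong, subst ennreal_plus[symmetric]) (auto intro: mult_right_mono)
    also have "\<dots> = mom (2*m+1) (\<lambda>s. ennreal (exp (- real (2*i+1) * s) - exp (- real (2*i+2) * s)))
            + mom (2*m+1) (\<lambda>s. ennreal (exp (- real (2*i+2) * s)))"
      by (rule mom_add) measurable
    finally have "ennreal (e (2*i)) =
        mom (2*m+1) (\<lambda>s. ennreal (exp (- real (2*i+1) * s) - exp (- real (2*i+2) * s)))
         + ennreal (e (2*i+1))"
      using mom_exp[of "real (2*i+1)" "2*m+1"] mom_exp[of "real (2*i+2)" "2*m+1"] 
      by (simp add: e_def add_ac del: power_Suc)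
    then have "mom (2*m+1) (\<lambda>s. ennreal (exp (- real (2*i+1) * s) - exp (- real (2*i+2) * s)))
        = ennreal (e (2*i)) - ennreal (e (2*i+1))"
      by simp
    then show ?thesis by (simp add: ennreal_minus e0)
  qed
  have "gmom (Suc m) 0 = mom (2*m+1) (\<lambda>s. ennreal (1 - sinh s / (cosh s + 1)))"
    by (simp add: gmom_Suc_eq)
  also have "\<dots> = mom (2*m+1) (\<lambda>s. 2 * ennreal (1 / (exp s + 1)))"
  proof (rule mom_cong)
    fix s :: real
    define t where "t = exp s"
    have t: "t > 0" by (simp add: t_def)
    have eq: "cosh s = (t + 1 / t) / 2" "sinh s = (t - 1 / t) / 2"
      by (simp_all add: cosh_field_def sinh_field_def t_def exp_minus inverse_eq_divide)
    have "cosh s + 1 = (t + 1)\<^sup>2 / (2 * t)" "cosh s + 1 - sinh s = (t + 1) / t"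
      using t by (simp_all add: eq field_simps power2_eq_square)
    moreover have "cosh s + 1 \<noteq> 0"
      using cosh_real_pos[of s] by linarith
    then have "1 - sinh s / (cosh s + 1) = (cosh s + 1 - sinh s) / (cosh s + 1)"
      by (simp add: diff_divide_distrib)
    ultimately have "1 - sinh s / (cosh s + 1) = ((t + 1) / t) / ((t + 1)\<^sup>2 / (2 * t))"
      by simp
    also have "\<dots> = 2 * (1 / (exp s + 1))"
      unfolding t_def[symmetric] using t
      by (simp add: power2_eq_square frac_eq_eq)
    finally have "1 - sinh s / (cosh s + 1) = 2 * (1 / (exp s + 1))" .
    then show "ennreal (1 - sinh s / (cosh s + 1)) = 2 * ennreal (1 / (exp s + 1))"
      by (simp only: ennreal_mult' ennreal_numeral)
  qed
  also have "\<dots> = 2 * mom (2*m+1) (\<lambda>s. ennreal (1 / (exp s + 1)))"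
    by (rule mom_cmult) measurable
  also have "mom (2*m+1) (\<lambda>s. ennreal (1 / (exp s + 1)))
     = (\<integral>\<^sup>+s. (\<Sum>i. ennreal (s ^ (2*m+1) / fact (2*m+1)) *
          ennreal (exp (- real (2*i+1) * s) - exp (- real (2*i+2) * s)) * indicator {0..} s) \<partial>lborel)"
    unfolding mom_def
  proof (rule nn_integral_cong, goal_cases)
    case (1 s)
    show ?case
    proof (cases "0 < s")
      case True
      have "(\<Sum>i. ennreal (exp (- real (2*i+1) * s) - exp (- real (2*i+2) * s))) = ennreal (1 / (exp s + 1))"
        using True fermi_suminf[OF True]
        by (intro suminf_ennreal_eq) (auto intro: mult_right_mono)
      then show ?thesis by (simp only: ennreal_suminf_cmult ennreal_suminf_multc)
    next
      \<comment> \<open>At \<open>s = 0\<close> the paired series gives 0 instead of 1/2, but the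
        weight \<open>s ^ (2*m+1)\<close> vanishes there.\<close>
      case False
      then show ?thesis by (cases "s = 0") auto
    qed
  qed
  also have "\<dots> = (\<Sum>i. ennreal (e (2*i) - e (2*i+1)))"
    by (subst nn_integral_suminf) (measurable, unfold mom_def[symmetric] mom_pair, rule refl)
  also have "\<dots> = ennreal (zetabar (2 * Suc m))"
    using pair edec by (intro suminf_ennreal_eq) auto
  finally show "gmom (Suc m) 0 = ennreal (zcoef (Suc m))"
    by (simp only: zcoef_def ennreal_mult' ennreal_numeral)
  show "0 \<le> zcoef (Suc m)"
    using sums_le[OF _ sums_zero pair] edec unfolding zcoef_def by simp
qed

section \<open>The moments of the kernel as polynomials in the angle\<close>

definition angle_poly :: "nat \<Rightarrow> real \<Rightarrow> real" where
  "angle_poly m \<alpha> = (\<Sum>i\<le>m. zcoef (m - i) * ((-1) ^ i * (\<alpha> ^ (2*i) / fact (2*i))))"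

text \<open>By \<open>gmom_Suc\<close>, the next moment is its value at 0 minus a double integral of
  the present one, and the polynomials obey the same recursion. Nonnegativity is carried through the
  induction, because it is what transfers identities between \<open>ennreal\<close> and the
  reals.\<close>

lemma gmom_eq_angle_poly:
  assumes "0 \<le> \<alpha>" "\<alpha> \<le> pi / 2"
  shows "0 \<le> angle_poly m \<alpha> \<and> gmom m \<alpha> = ennreal (angle_poly m \<alpha>)"
  using assms
proof (induction m arbitrary: \<alpha>)
  case 0
  then show ?case by (simp add: angle_poly_def gmom_0 cos_ge_zero)
next
  case (Suc m)
  \<comment> \<open>\<open>P k\<close> is the \<open>k\<close>-fold antiderivative of
    \<open>angle_poly m\<close>, each one vanishing at 0.\<close>
  define P where "P = (\<lambda>k \<beta>. \<Sum>i\<le>m. zcoef (m - i) * ((-1) ^ i * (\<beta> ^ (2*i+k) / fact (2*i+k))))"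
  have P0: "P 0 = angle_poly m" by (auto simp: P_def angle_poly_def)
  have DP: "(P (Suc k) has_real_derivative P k x) (at x)" for k x
    unfolding P_def add_Suc_right
    by (intro DERIV_sum DERIV_cmult DERIV_divided_power)
  have [measurable]: "P k \<in> borel_measurable borel" for k
    unfolding P_def by (intro borel_measurable_continuous_onI continuous_intros) auto
  have Pz: "P (Suc k) 0 = 0" for k by (simp add: P_def)
  have step: "0 \<le> P (Suc k) \<beta> \<and> (\<integral>\<^sup>+\<gamma>\<in>{0..\<beta>}. P k \<gamma> \<partial>lborel) = ennreal (P (Suc k) \<beta>)"
    if "\<And>\<gamma>. \<gamma> \<in> {0..\<alpha>} \<Longrightarrow> 0 \<le> P k \<gamma>" "\<beta> \<in> {0..\<alpha>}" for k \<beta>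
  proof
    have "P (Suc k) 0 \<le> P (Suc k) \<beta>"
    proof (rule DERIV_nonneg_imp_nondecreasing[where f = "P (Suc k)"])
      show "\<exists>y. (P (Suc k) has_real_derivative y) (at x) \<and> 0 \<le> y" if "0 \<le> x" "x \<le> \<beta>" for x
        using that \<open>\<beta> \<in> {0..\<alpha>}\<close> \<open>\<And>\<gamma>. \<gamma> \<in> {0..\<alpha>} \<Longrightarrow> 0 \<le> P k \<gamma>\<close>[of x] DP[of k x] by auto
    qed (use that in auto)
    then show "0 \<le> P (Suc k) \<beta>" by (simp add: Pz)
    have "(\<integral>\<^sup>+\<gamma>\<in>{0..\<beta>}. P k \<gamma> \<partial>lborel) = ennreal (P (Suc k) \<beta> - P (Suc k) 0)"
      using that by (intro nn_integral_FTC_Icc[where F = "P (Suc k)"] DP) auto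
    then show "(\<integral>\<^sup>+\<gamma>\<in>{0..\<beta>}. P k \<gamma> \<partial>lborel) = ennreal (P (Suc k) \<beta>)" by (simp add: Pz)
  qed
  have n0: "0 \<le> P 0 \<gamma>" "gmom m \<gamma> = ennreal (P 0 \<gamma>)" if "\<gamma> \<in> {0..\<alpha>}" for \<gamma>
    using Suc.IH[of \<gamma>] Suc.prems that by (auto simp: P0)
  have inner: "(\<integral>\<^sup>+\<gamma>\<in>{0..\<beta>}. gmom m \<gamma> \<partial>lborel) = ennreal (P 1 \<beta>)" if "\<beta> \<in> {0..\<alpha>}" for \<beta>
  proof -
    have "(\<integral>\<^sup>+\<gamma>\<in>{0..\<beta>}. gmom m \<gamma> \<partial>lborel) = (\<integral>\<^sup>+\<gamma>\<in>{0..\<beta>}. P 0 \<gamma> \<partial>lborel)"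
      using n0 that by (intro nn_integral_cong) (auto simp: indicator_def)
    then show ?thesis using step[OF n0(1) that] by simp
  qed
  have P2: "(\<integral>\<^sup>+\<beta>\<in>{0..\<alpha>}. P 1 \<beta> \<partial>lborel) = ennreal (P 2 \<alpha>)" "0 \<le> P 2 \<alpha>"
    using step[of 1 \<alpha>] step[OF n0(1)] Suc.prems by (auto simp: numeral_2_eq_2)
  have "(\<integral>\<^sup>+\<beta>\<in>{0..\<alpha>}. (\<integral>\<^sup>+\<gamma>\<in>{0..\<beta>}. gmom m \<gamma> \<partial>lborel) \<partial>lborel) = (\<integral>\<^sup>+\<beta>\<in>{0..\<alpha>}. P 1 \<beta> \<partial>lborel)"
    using inner by (intro nn_integral_cong) (auto simp: indicator_def)
  also note P2(1)
  finally have eq: "gmom (Suc m) \<alpha> + ennreal (P 2 \<alpha>) = ennreal (zcoef (Suc m))"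
    using gmom_Suc[OF Suc.prems, of m] by (simp add: gmom_Suc_0)
  \<comment> \<open>The term \<open>i = 0\<close> is \<open>zcoef (Suc m)\<close>; shifting the
    index in the others flips their sign and gives \<open>- P 2 \<alpha>\<close>.\<close>
  have "angle_poly (Suc m) \<alpha> = zcoef (Suc m) - P 2 \<alpha>"
    unfolding angle_poly_def P_def by (subst sum.atMost_Suc_shift) (simp add: sum_negf)
  moreover have "gmom (Suc m) \<alpha> = ennreal (zcoef (Suc m)) - ennreal (P 2 \<alpha>)"
    unfolding eq[symmetric] by simp
  \<comment> \<open>In the reals, this is the nonnegativity of
    \<open>angle_poly (Suc m) \<alpha>\<close>.\<close>
  moreover have "ennreal (P 2 \<alpha>) \<le> ennreal (zcoef (Suc m))"
    unfolding eq[symmetric] by simp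
  ultimately show ?case
    using \<open>0 \<le> P 2 \<alpha>\<close> zcoef_Suc_nonneg[of m] by (simp add: ennreal_minus)
qed

section \<open>The numbers Z\<close>

lemma chains_0: "chains j p 0 = (if j = p then {[j]} else {})"
  by (auto simp: chains_def length_Suc_conv)

lemma chains_Suc: "chains j p (Suc k) = (\<Union>i\<in>{j<..p}. Cons j ` chains i p k)"
proof (intro equalityI subsetI)
  fix x assume x: "x \<in> chains j p (Suc k)"
  then obtain xs where xs: "x = j # xs" "length xs = k + 1"
    by (auto simp: chains_def length_Suc_conv)
  have srt: "sorted_wrt (<) xs" "\<forall>y\<in>set xs. j < y" "set xs \<subseteq> {j..p}" "xs ! k = p"
    using x by (auto simp: chains_def xs)
  have "xs ! 0 \<in> set xs" using xs by (intro nth_mem) simp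
  moreover have "xs ! 0 \<le> y" if "y \<in> set xs" for y
    using that srt(1) xs(2) by (cases xs) auto
  ultimately have "xs ! 0 \<in> {j<..p}" "xs \<in> chains (xs ! 0) p k"
    using srt xs by (auto simp: chains_def)
  then show "x \<in> (\<Union>i\<in>{j<..p}. Cons j ` chains i p k)" using xs by blast
next
  fix x assume "x \<in> (\<Union>i\<in>{j<..p}. Cons j ` chains i p k)"
  then show "x \<in> chains j p (Suc k)" by (fastforce simp: chains_def)
qed

lemma finite_chains: "finite (chains j p k)"
proof (rule finite_subset)
  show "chains j p k \<subseteq> {xs. set xs \<subseteq> {j..p} \<and> length xs = k + 1}"
    by (auto simp: chains_def)
qed (simp add: finite_lists_length_eq)

lemma chains_empty:
  assumes "j \<le> p" "p - j < k"
  shows "chains j p k = {}"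
proof (rule ccontr)
  assume "chains j p k \<noteq> {}"
  then obtain x where x: "length x = k + 1" "sorted_wrt (<) x" "set x \<subseteq> {j..p}"
    by (auto simp: chains_def)
  then have "card (set x) = k + 1" by (simp add: strict_sorted_iff distinct_card)
  moreover have "card (set x) \<le> card {j..p}" using x by (intro card_mono) auto
  ultimately show False using assms by simp
qed

definition chain_sum :: "nat \<Rightarrow> nat \<Rightarrow> nat \<Rightarrow> real" where
  "chain_sum j p k = (\<Sum>is\<in>chains j p k. \<Prod>l=1..k. zetabar (2 * (is ! l) - 2 * (is ! (l - 1))))"

lemma chain_sum_Suc:
  "chain_sum j p (Suc k) = (\<Sum>i\<in>{j<..p}. zetabar (2 * (i - j)) * chain_sum i p k)"
proof -
  have "chain_sum j p (Suc k) = (\<Sum>i\<in>{j<..p}. \<Sum>x\<in>Cons j ` chains i p k.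
      \<Prod>l=1..Suc k. zetabar (2 * (x ! l) - 2 * (x ! (l - 1))))"
    unfolding chain_sum_def chains_Suc
    by (rule sum.UNION_disjoint) (auto simp: finite_chains, auto simp: chains_def)
  also have "\<dots> = (\<Sum>i\<in>{j<..p}. zetabar (2 * (i - j)) * chain_sum i p k)"
  proof (rule sum.cong[OF refl])
    fix i
    have "(\<Prod>l=1..Suc k. zetabar (2 * ((j # is) ! l) - 2 * ((j # is) ! (l - 1))))
        = zetabar (2 * (i - j)) * (\<Prod>l=1..k. zetabar (2 * (is ! l) - 2 * (is ! (l - 1))))"
      if "is \<in> chains i p k" for "is"
    proof -
      have "(\<Prod>l=1..Suc k. zetabar (2 * ((j # is) ! l) - 2 * ((j # is) ! (l - 1))))
        = zetabar (2 * (is ! 0) - 2 * j) *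
            (\<Prod>l=1..k. zetabar (2 * ((j # is) ! Suc l) - 2 * ((j # is) ! (Suc l - 1))))"
        by (subst prod.atLeast_Suc_atMost)
           (simp_all only: prod.shift_bounds_cl_Suc_ivl One_nat_def, simp_all)
      also have "(\<Prod>l=1..k. zetabar (2 * ((j # is) ! Suc l) - 2 * ((j # is) ! (Suc l - 1))))
          = (\<Prod>l=1..k. zetabar (2 * (is ! l) - 2 * (is ! (l - 1))))"
        by (rule prod.cong) (auto simp: nth_Cons')
      finally show ?thesis using that by (simp add: chains_def diff_mult_distrib2)
    qed
    then show "(\<Sum>x\<in>Cons j ` chains i p k. \<Prod>l=1..Suc k. zetabar (2 * (x ! l) - 2 * (x ! (l - 1))))
        = zetabar (2 * (i - j)) * chain_sum i p k"
      unfolding chain_sum_def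
      by (subst sum.reindex) (auto simp: sum_distrib_left o_def intro!: sum.cong)
  qed
  finally show ?thesis .
qed

text \<open>Chains with more than \<open>p - j\<close> links do not exist, so the range of
  \<open>k\<close> may be enlarged to a bound common to several \<open>j\<close>. The added term
  \<open>k = 0\<close> is 1 for \<open>j = p\<close> and 0 otherwise, which absorbs the case
  distinction in \<open>Z\<close>.\<close>

lemma Z_eq_chain_sum:
  assumes "j \<le> p" "p - j \<le> N"
  shows "Z j p = (\<Sum>k\<le>N. (-2) ^ k * chain_sum j p k)"
proof -
  have "(\<Sum>k\<le>N. (-2) ^ k * chain_sum j p k) = (\<Sum>k\<le>p-j. (-2) ^ k * chain_sum j p k)"
    using assms by (intro sum.mono_neutral_right) (auto simp: chain_sum_def chains_empty)
  also have "\<dots> = chain_sum j p 0 + (\<Sum>k=1..p-j. (-2) ^ k * chain_sum j p k)"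
    by (simp add: atMost_atLeast0 sum.atLeast_Suc_atMost)
  also have "\<dots> = Z j p"
    by (auto simp: Z_def chain_sum_def chains_0)
  finally show ?thesis by simp
qed

text \<open>Chains are split at their second entry \<open>i\<close>; the first link contributes
  \<open>-2 * zetabar (2 * (i - j)) = - zcoef (i - j)\<close>.\<close>

lemma Z_rec:
  assumes "j < p"
  shows "Z j p = - (\<Sum>i\<in>{j<..p}. zcoef (i - j) * Z i p)"
proof -
  \<comment> \<open>The bound \<open>Suc q\<close> on the number of links serves \<open>j\<close>,
    and \<open>q\<close> serves every \<open>i > j\<close>; this matches the shift of
    \<open>k\<close> by one.\<close>
  obtain q where q: "p = Suc q" using assms by (cases p) auto
  have "Z j p = (\<Sum>k\<le>Suc q. (-2) ^ k * chain_sum j p k)"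
    using assms q by (intro Z_eq_chain_sum) auto
  also have "\<dots> = chain_sum j p 0 + (\<Sum>k\<le>q. (-2) ^ Suc k * chain_sum j p (Suc k))"
    by (subst sum.atMost_Suc_shift) simp
  also have "chain_sum j p 0 = 0" using assms by (simp add: chain_sum_def chains_0)
  also have "(\<Sum>k\<le>q. (-2) ^ Suc k * chain_sum j p (Suc k))
      = (\<Sum>k\<le>q. \<Sum>i\<in>{j<..p}. - zcoef (i - j) * ((-2) ^ k * chain_sum i p k))"
    unfolding chain_sum_Suc sum_distrib_left zcoef_def
    by (intro sum.cong refl) simp
  also have "\<dots> = (\<Sum>i\<in>{j<..p}. - zcoef (i - j) * (\<Sum>k\<le>q. (-2) ^ k * chain_sum i p k))"
    by (subst sum.swap) (simp add: sum_distrib_left)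
  also have "\<dots> = (\<Sum>i\<in>{j<..p}. - zcoef (i - j) * Z i p)"
    using q by (intro sum.cong refl, subst Z_eq_chain_sum[where N = q]) auto
  finally show ?thesis by (simp add: sum_negf)
qed

text \<open>The convention \<open>zetabar 0 = 1 / 2\<close> gives this series the constant term 1,
  so it is invertible.\<close>

definition zfps :: "real fps" where
  "zfps = Abs_fps zcoef"

text \<open>Comparing coefficients in \<open>zfps * inverse zfps = 1\<close> gives the recursion of
  \<open>Z_rec\<close>. In particular \<open>Z j p\<close> depends only on
  \<open>p - j\<close>.\<close>

lemma Z_eq_inverse_zfps:
  assumes "j \<le> p"
  shows "Z j p = fps_nth (inverse zfps) (p - j)"
  using assms
proof (induction "p - j" arbitrary: j rule: less_induct)
  case less
  show ?case
  proof (cases "j = p")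
    case True
    then show ?thesis by (simp add: Z_def zfps_def)
  next
    case False
    define n where "n = p - j"
    have n: "0 < n" "p = j + n" using less.prems False by (auto simp: n_def)
    have "zfps * inverse zfps = 1"
      by (rule inverse_mult_eq_1') (simp add: zfps_def)
    then have "(\<Sum>i=0..n. zcoef i * fps_nth (inverse zfps) (n - i)) = 0"
      using n fps_mult_nth[of zfps "inverse zfps" n] by (simp add: zfps_def)
    then have *: "fps_nth (inverse zfps) n = - (\<Sum>i=1..n. zcoef i * fps_nth (inverse zfps) (n - i))"
      by (simp add: sum.atLeast_Suc_atMost)
    have "Z j p = - (\<Sum>i\<in>{j<..p}. zcoef (i - j) * Z i p)"
      using n by (intro Z_rec) simp
    also have "(\<Sum>i\<in>{j<..p}. zcoef (i - j) * Z i p)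
        = (\<Sum>i\<in>{j<..p}. zcoef (i - j) * fps_nth (inverse zfps) (p - i))"
      by (intro sum.cong refl, subst less.hyps) auto
    also have "\<dots> = (\<Sum>i=1..n. zcoef i * fps_nth (inverse zfps) (n - i))"
      by (rule sum.reindex_bij_witness[of _ "\<lambda>i. i + j" "\<lambda>i. i - j"]) (auto simp: n algebra_simps)
    finally show ?thesis using * by (simp add: n_def)
  qed
qed

text \<open>Both sides equal \<open>\<Sum>i j. z (m - i) * z (p - j) * Y i j\<close>, where \<open>z\<close> are the coefficients of
  \<open>inverse zfps\<close> and \<open>Y m j\<close> is the symmetric sum in the assumption.\<close>
lemma inverse_toeplitz_symmetric:
  fixes X :: "nat \<Rightarrow> nat \<Rightarrow> real"
  assumes sym: "\<And>m j. (\<Sum>i\<le>m. zcoef (m - i) * X i j) = (\<Sum>i\<le>j. zcoef (j - i) * X i m)"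
  shows "(\<Sum>j\<le>p. X m j * fps_nth (inverse zfps) (p - j)) = (\<Sum>j\<le>m. X p j * fps_nth (inverse zfps) (m - j))"
proof -
  define Y where "Y = (\<lambda>m j. \<Sum>i\<le>m. zcoef (m - i) * X i j)"
  define z where "z = (\<lambda>n. fps_nth (inverse zfps) n)"
  \<comment> \<open>For fixed \<open>j\<close>, passing from \<open>X\<close> to \<open>Y\<close>
    multiplies the series in the first index by \<open>zfps\<close>; multiplying by the inverse
    recovers \<open>X\<close>.\<close>
  have X: "X m j = (\<Sum>i\<le>m. z (m - i) * Y i j)" for m j
  proof -
    define F where "F = Abs_fps (\<lambda>i. X i j)"
    have "Y i j = fps_nth (F * zfps) i" for i
      unfolding Y_def fps_mult_nth
      by (auto simp: F_def zfps_def atMost_atLeast0 intro!: sum.cong)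
    then have "(\<Sum>i\<le>m. z (m - i) * Y i j) = fps_nth ((F * zfps) * inverse zfps) m"
      unfolding fps_mult_nth[of _ "inverse zfps"]
      by (auto simp: z_def atMost_atLeast0 intro!: sum.cong)
    also have "(F * zfps) * inverse zfps = F"
      by (simp add: mult.assoc inverse_mult_eq_1' zfps_def)
    finally show ?thesis by (simp add: F_def)
  qed
  have eq: "(\<Sum>j\<le>p. X m j * z (p - j)) = (\<Sum>j\<le>p. \<Sum>i\<le>m. z (m - i) * z (p - j) * Y i j)" for m p
    by (subst X) (simp add: sum_distrib_left sum_distrib_right mult_ac)
  moreover have "Y i j = Y j i" for i j
    unfolding Y_def by (rule sym)
  ultimately have "(\<Sum>j\<le>p. X m j * z (p - j)) = (\<Sum>j\<le>p. \<Sum>i\<le>m. z (m - i) * z (p - j) * Y j i)"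
    by simp
  also have "\<dots> = (\<Sum>i\<le>m. \<Sum>j\<le>p. z (p - j) * z (m - i) * Y j i)"
    by (subst sum.swap) (simp add: mult_ac)
  also have "\<dots> = (\<Sum>j\<le>m. X p j * z (m - j))"
    by (rule eq[symmetric])
  finally show ?thesis unfolding z_def .
qed

section \<open>Coefficients of the series for W\<close>

text \<open>For a reversed index list \<open>ks\<close> of length \<open>r\<close>, \<open>tcoef ks l\<close> is the sum of all terms of the
  series with \<open>n\<^sub>r = r + l\<close>, without the sign; \<open>2 n\<^sub>r - r\<close> is then \<open>r + 2 l\<close>.\<close>
fun tcoef :: "nat list \<Rightarrow> nat \<Rightarrow> real" where
  "tcoef [] l = of_bool (l = 0)"
| "tcoef (k # ks) l = (\<Sum>i\<le>l. tcoef ks i) / real (Suc (length ks) + 2 * l) ^ k"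

lemma tcoef_nonneg: "0 \<le> tcoef ks l"
  by (induction ks arbitrary: l) (auto intro!: divide_nonneg_nonneg sum_nonneg)

section \<open>Index lists and partial sums of the T-series\<close>

lemma T_index_0: "T_index 0 N = {[]}"
  by (auto simp: T_index_def)

lemma T_index_Suc: "T_index (Suc r) N = (\<Union>n\<in>{1..N}. (\<lambda>ns. ns @ [n]) ` T_index r (n - 1))"
proof (intro equalityI subsetI)
  fix x assume x: "x \<in> T_index (Suc r) N"
  then have "x \<noteq> []" by (auto simp: T_index_def)
  then obtain ns n where ns: "x = ns @ [n]" by (metis append_butlast_last_id)
  have "n \<in> {1..N}" "ns \<in> T_index r (n - 1)"
    using x by (force simp: T_index_def ns sorted_wrt_append)+
  then show "x \<in> (\<Union>n\<in>{1..N}. (\<lambda>ns. ns @ [n]) ` T_index r (n - 1))" using ns by blast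
next
  fix x assume "x \<in> (\<Union>n\<in>{1..N}. (\<lambda>ns. ns @ [n]) ` T_index r (n - 1))"
  then show "x \<in> T_index (Suc r) N"
    by (force simp: T_index_def sorted_wrt_append)
qed

lemma finite_T_index: "finite (T_index r N)"
proof (rule finite_subset)
  show "T_index r N \<subseteq> {xs. set xs \<subseteq> {0..N} \<and> length xs = r}"
    by (auto simp: T_index_def)
qed (simp add: finite_lists_length_eq)

lemma T_index_empty: "N < r \<Longrightarrow> T_index r N = {}"
proof (induction r arbitrary: N)
  case (Suc r)
  then show ?case by (auto simp: T_index_Suc)
qed simp

lemma sum_T_index_Suc:
  "(\<Sum>ns\<in>T_index (Suc r) N. f ns) = (\<Sum>n=1..N. \<Sum>ns\<in>T_index r (n - 1). f (ns @ [n]))"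
proof -
  have "(\<Sum>ns\<in>T_index (Suc r) N. f ns)
      = (\<Sum>n=1..N. \<Sum>ns\<in>(\<lambda>ns. ns @ [n]) ` T_index r (n - 1). f ns)"
    unfolding T_index_Suc by (rule sum.UNION_disjoint) (auto simp: finite_T_index)
  then show ?thesis by (simp add: sum.reindex inj_on_def)
qed

definition tprod :: "nat list \<Rightarrow> nat list \<Rightarrow> real" where
  "tprod ks ns = (\<Prod>i<length ks. 1 / (2 * real (ns ! i) - real (i + 1)) ^ (ks ! i))"

lemma tprod_snoc:
  "length ns = length ks \<Longrightarrow>
    tprod (ks @ [k]) (ns @ [n]) = tprod ks ns / (2 * real n - real (Suc (length ks))) ^ k"
  unfolding tprod_def by (simp add: nth_append add.commute)

text \<open>Lists are built up by their largest entry, which belongs to the last exponent; hence the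
  reversal. A strictly increasing list of \<open>r\<close> positive integers has last entry at least
  \<open>r\<close>, so the bound \<open>length ks + L\<close> corresponds to
  \<open>l \<le> L\<close>. The sign depends only on the last entry and so enters only in the
  outermost sum.\<close>

lemma sum_T_index_tprod:
  shows "(\<Sum>ns\<in>T_index (length ks) (length ks + L). tprod (rev ks) ns) = (\<Sum>l\<le>L. tcoef ks l)"
    and "ks \<noteq> [] \<Longrightarrow>
      (\<Sum>ns\<in>T_index (length ks) (length ks + L). (-1) ^ last ns * tprod (rev ks) ns)
      = (\<Sum>l\<le>L. (-1) ^ (length ks + l) * tcoef ks l)"
proof -
  \<comment> \<open>An arbitrary weight \<open>g\<close> on the last entry covers both claims: the
    constant 1 and the sign \<open>(-1) ^ n\<close>.\<close>
  have snoc: "(\<Sum>ns\<in>T_index (Suc (length ks)) (Suc (length ks) + L). g (last ns) * tprod (rev (k # ks)) ns)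
      = (\<Sum>l\<le>L. g (Suc (length ks) + l) * tcoef (k # ks) l)"
    if IH: "\<And>L. (\<Sum>ns\<in>T_index (length ks) (length ks + L). tprod (rev ks) ns) = (\<Sum>l\<le>L. tcoef ks l)"
    for ks k L and g :: "nat \<Rightarrow> real"
  proof -
    define r where "r = length ks"
    define h where "h = (\<lambda>n. g n * ((\<Sum>ns\<in>T_index r (n - 1). tprod (rev ks) ns) / (2 * real n - real (Suc r)) ^ k))"
    have "(\<Sum>ns\<in>T_index (Suc r) (Suc r + L). g (last ns) * tprod (rev (k # ks)) ns)
        = (\<Sum>n=1..Suc r + L. h n)"
      unfolding sum_T_index_Suc h_def sum_distrib_left sum_divide_distrib
      by (intro sum.cong refl) (auto simp: tprod_snoc T_index_def r_def)
    \<comment> \<open>For \<open>n \<le> r\<close> no list of length \<open>r\<close> fits below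
      \<open>n\<close>.\<close>
    also have "\<dots> = (\<Sum>n=Suc r..Suc r + L. h n)"
      by (rule sum.mono_neutral_right) (auto simp: h_def T_index_empty)
    also have "\<dots> = (\<Sum>l\<le>L. h (Suc r + l))"
      by (rule sum.reindex_bij_witness[of _ "\<lambda>l. Suc r + l" "\<lambda>n. n - Suc r"]) auto
    also have "\<dots> = (\<Sum>l\<le>L. g (Suc r + l) * tcoef (k # ks) l)"
    proof (rule sum.cong[OF refl])
      fix l
      have "2 * real (Suc r + l) - real (Suc r) = real (Suc r + 2 * l)" by simp
      then show "h (Suc r + l) = g (Suc r + l) * tcoef (k # ks) l"
        unfolding h_def by (simp add: IH r_def)
    qed
    finally show ?thesis by (simp add: r_def)
  qed
  have A: "(\<Sum>ns\<in>T_index (length ks) (length ks + L). tprod (rev ks) ns) = (\<Sum>l\<le>L. tcoef ks l)" for ks L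
  proof (induction ks arbitrary: L)
    case Nil
    then show ?case by (simp add: T_index_0 tprod_def)
  next
    case (Cons k ks)
    then show ?case using snoc[of ks "\<lambda>_. 1" k L] by simp
  qed
  then show "(\<Sum>ns\<in>T_index (length ks) (length ks + L). tprod (rev ks) ns) = (\<Sum>l\<le>L. tcoef ks l)" .
  show "(\<Sum>ns\<in>T_index (length ks) (length ks + L). (-1) ^ last ns * tprod (rev ks) ns)
      = (\<Sum>l\<le>L. (-1) ^ (length ks + l) * tcoef ks l)" if "ks \<noteq> []"
    using that snoc[OF A, of "\<lambda>n. (-1) ^ n"] by (cases ks) auto
qed

text \<open>The partial sums over last entries up to \<open>N\<close> are partial sums in
  \<open>l\<close>, shifted by \<open>r\<close>. The sign \<open>(-1) ^ r\<close> and the factor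
  \<open>2 ^ r\<close> combine to \<open>(-2) ^ r\<close>, and summability makes \<open>lim\<close>
  a genuine limit.\<close>

lemma Tbar_rev:
  assumes "ks \<noteq> []" "summable (\<lambda>l. (-1) ^ l * tcoef ks l)"
  shows "Tbar (rev ks) = (-2) ^ length ks * (\<Sum>l. (-1) ^ l * tcoef ks l)"
proof -
  define r where "r = length ks"
  have "(\<lambda>L. \<Sum>l\<le>L. (-1) ^ l * tcoef ks l) \<longlonglongrightarrow> (\<Sum>l. (-1) ^ l * tcoef ks l)"
    using summable_LIMSEQ'[OF assms(2)] .
  then have "(\<lambda>L. (-1) ^ r * (\<Sum>l\<le>L. (-1) ^ l * tcoef ks l))
      \<longlonglongrightarrow> (-1) ^ r * (\<Sum>l. (-1) ^ l * tcoef ks l)"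
    by (intro tendsto_intros)
  moreover have "(-1) ^ r * (\<Sum>l\<le>L. (-1) ^ l * tcoef ks l) = Tbar_partial (rev ks) (L + r)" for L
    using sum_T_index_tprod(2)[OF assms(1), of L]
    by (simp add: Tbar_partial_def tprod_def r_def sum_distrib_left power_add mult_ac add.commute)
  ultimately have "(\<lambda>L. Tbar_partial (rev ks) (L + r)) \<longlonglongrightarrow> (-1) ^ r * (\<Sum>l. (-1) ^ l * tcoef ks l)"
    by simp
  then have "lim (Tbar_partial (rev ks)) = (-1) ^ r * (\<Sum>l. (-1) ^ l * tcoef ks l)"
    by (intro limI) (rule LIMSEQ_offset)
  then show ?thesis
    using assms(1) by (simp add: Tbar_def r_def flip: power_mult_distrib mult.assoc)
qed

section \<open>Compositions and the coefficients of the sum over them\<close>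

lemma Icomp_0: "Icomp n 0 = (if n = 0 then {[]} else {})"
  by (auto simp: Icomp_def)

definition inc_hd :: "nat list \<Rightarrow> nat list" where
  "inc_hd ks = Suc (hd ks) # tl ks"

text \<open>The first part is either 1 or larger; the two cases become the two terms of
  \<open>wcoef_Suc\<close>.\<close>

lemma Icomp_Suc_Suc:
  "Icomp (Suc n) (Suc r) = Cons 1 ` Icomp n r \<union> inc_hd ` Icomp n (Suc r)"
proof (intro equalityI subsetI)
  fix x assume x: "x \<in> Icomp (Suc n) (Suc r)"
  then obtain k ks where ks: "x = k # ks" by (auto simp: Icomp_def length_Suc_conv)
  show "x \<in> Cons 1 ` Icomp n r \<union> inc_hd ` Icomp n (Suc r)"
  proof (cases "k = 1")
    case True
    then show ?thesis using x by (auto simp: Icomp_def ks)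
  next
    case False
    then have "x = inc_hd ((k - 1) # ks)" "(k - 1) # ks \<in> Icomp n (Suc r)"
      using x by (auto simp: Icomp_def ks inc_hd_def)
    then show ?thesis by blast
  qed
next
  fix x assume "x \<in> Cons 1 ` Icomp n r \<union> inc_hd ` Icomp n (Suc r)"
  then show "x \<in> Icomp (Suc n) (Suc r)"
    by (auto simp: Icomp_def inc_hd_def length_Suc_conv)
qed

lemma Icomp_empty: "n < r \<Longrightarrow> Icomp n r = {}"
proof (induction n arbitrary: r)
  case 0
  then show ?case by (auto simp: Icomp_def) (metis last_in_set less_irrefl)
next
  case (Suc n)
  then show ?case by (cases r) (auto simp: Icomp_Suc_Suc)
qed

lemma finite_Icomp: "finite (Icomp n r)"
proof (induction n arbitrary: r)
  case 0
  then show ?case by (cases r) (auto simp: Icomp_0 Icomp_empty)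
next
  case (Suc n)
  then show ?case by (cases r) (auto simp: Icomp_Suc_Suc Icomp_0)
qed

text \<open>The parameter \<open>d\<close> is the excess of weight over depth: deleting a part 1
  lowers \<open>r\<close> and keeps \<open>d\<close>, while decreasing a part lowers
  \<open>d\<close> and keeps \<open>r\<close>.\<close>

definition wcoef :: "nat \<Rightarrow> nat \<Rightarrow> nat \<Rightarrow> real" where
  "wcoef r d l = (\<Sum>ks\<in>Icomp (r + d) r. tcoef ks l)"

lemma wcoef_0: "wcoef 0 d l = of_bool (d = 0 \<and> l = 0)"
  by (simp add: wcoef_def Icomp_0)

text \<open>The factor on the left cancels one power of the outermost denominator. A first part 1
  then disappears and leaves the inner sum over \<open>i \<le> l\<close>; a larger one drops by
  1.\<close>

lemma wcoef_Suc:
  "real (Suc r + 2 * l) * wcoef (Suc r) d l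
    = (\<Sum>i\<le>l. wcoef r d i) + (if d = 0 then 0 else wcoef (Suc r) (d - 1) l)"
proof -
  define \<mu> where "\<mu> = real (Suc r + 2 * l)"
  have \<mu>: "\<mu> \<noteq> 0" by (simp add: \<mu>_def)
  have "\<mu> * wcoef (Suc r) d l = (\<Sum>ks\<in>Icomp (Suc (r + d)) (Suc r). \<mu> * tcoef ks l)"
    by (simp add: wcoef_def sum_distrib_left)
  also have "\<dots> = (\<Sum>ks\<in>Cons 1 ` Icomp (r + d) r. \<mu> * tcoef ks l)
      + (\<Sum>ks\<in>inc_hd ` Icomp (r + d) (Suc r). \<mu> * tcoef ks l)"
    unfolding Icomp_Suc_Suc
  proof (rule sum.union_disjoint)
    have "hd x = 1" "hd y > 1"
      if "x \<in> Cons 1 ` Icomp (r + d) r" "y \<in> inc_hd ` Icomp (r + d) (Suc r)" for x y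
      using that by (auto simp: inc_hd_def Icomp_def length_Suc_conv)
    then show "Cons 1 ` Icomp (r + d) r \<inter> inc_hd ` Icomp (r + d) (Suc r) = {}"
      by (metis disjoint_iff less_irrefl)
  qed (auto simp: finite_Icomp)
  also have "(\<Sum>ks\<in>Cons 1 ` Icomp (r + d) r. \<mu> * tcoef ks l)
      = (\<Sum>ks\<in>Icomp (r + d) r. \<Sum>i\<le>l. tcoef ks i)"
    using \<mu> by (subst sum.reindex) (auto simp: \<mu>_def Icomp_def intro!: sum.cong)
  also have "\<dots> = (\<Sum>i\<le>l. wcoef r d i)"
    unfolding wcoef_def by (rule sum.swap)
  also have "(\<Sum>ks\<in>inc_hd ` Icomp (r + d) (Suc r). \<mu> * tcoef ks l) = (\<Sum>ks\<in>Icomp (r + d) (Suc r). tcoef ks l)"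
  proof (subst sum.reindex)
    show "inj_on inc_hd (Icomp (r + d) (Suc r))"
    proof (rule inj_onI)
      fix x y assume xy: "x \<in> Icomp (r + d) (Suc r)" "y \<in> Icomp (r + d) (Suc r)" "inc_hd x = inc_hd y"
      then have "x \<noteq> []" "y \<noteq> []" by (auto simp: Icomp_def)
      then show "x = y" using xy(3) by (simp add: inc_hd_def list.expand)
    qed
    show "sum ((\<lambda>ks. \<mu> * tcoef ks l) \<circ> inc_hd) (Icomp (r + d) (Suc r)) = (\<Sum>ks\<in>Icomp (r + d) (Suc r). tcoef ks l)"
    proof (rule sum.cong[OF refl])
      fix ks assume "ks \<in> Icomp (r + d) (Suc r)"
      then obtain k ks' where "ks = k # ks'" "length ks' = r" by (auto simp: Icomp_def length_Suc_conv)
      then show "((\<lambda>ks. \<mu> * tcoef ks l) \<circ> inc_hd) ks = tcoef ks l"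
        using \<mu> by (simp add: inc_hd_def flip: \<mu>_def) (simp add: \<mu>_def add_ac)
    qed
  qed
  \<comment> \<open>For \<open>d = 0\<close> there is no composition of \<open>r\<close> into
    \<open>Suc r\<close> parts.\<close>
  also have "\<dots> = (if d = 0 then 0 else wcoef (Suc r) (d - 1) l)"
    by (cases d) (auto simp: wcoef_def Icomp_empty)
  finally show ?thesis by (simp only: \<mu>_def)
qed

text \<open>Reversal permutes the compositions, so the reversed convention of \<open>tcoef\<close>
  disappears in the sum.\<close>

lemma W_eq:
  assumes "0 < r" "\<And>ks. ks \<in> Icomp (r + d) r \<Longrightarrow> summable (\<lambda>l. (-1) ^ l * tcoef ks l)"
  shows "W (r + d) r = (-2) ^ r * (\<Sum>l. (-1) ^ l * wcoef r d l)"
proof -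
  have "W (r + d) r = (\<Sum>ks\<in>Icomp (r + d) r. Tbar (rev ks))"
    unfolding W_def by (rule sum.reindex_bij_witness[of _ rev rev]) (auto simp: Icomp_def)
  also have "\<dots> = (\<Sum>ks\<in>Icomp (r + d) r. (-2) ^ r * (\<Sum>l. (-1) ^ l * tcoef ks l))"
    using assms by (intro sum.cong refl, subst Tbar_rev) (auto simp: Icomp_def)
  also have "\<dots> = (-2) ^ r * (\<Sum>l. \<Sum>ks\<in>Icomp (r + d) r. (-1) ^ l * tcoef ks l)"
    using assms by (subst suminf_sum) (auto simp: sum_distrib_left)
  finally show ?thesis by (simp add: wcoef_def sum_distrib_left)
qed

section \<open>Convergence: coefficients of bounded variation\<close>

text \<open>Multiplication by \<open>1 + q\<close> turns the series into one with coefficients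
  \<open>b (Suc l) - b l\<close>, which converges absolutely and uniformly on [0, 1]. Bounded
  variation takes the place of the monotonicity in Leibniz's criterion and yields continuity up to
  \<open>q = 1\<close>.\<close>

lemma alternating_powser:
  fixes b :: "nat \<Rightarrow> real"
  assumes lim: "b \<longlonglongrightarrow> 0" and var: "summable (\<lambda>l. \<bar>b (Suc l) - b l\<bar>)"
  shows summable_alternating_powser:
      "0 \<le> q \<Longrightarrow> q \<le> 1 \<Longrightarrow> summable (\<lambda>l. (-1) ^ l * b l * q ^ l)"
    and continuous_on_alternating_powser:
      "continuous_on {0..1} (\<lambda>q. \<Sum>l. (-1) ^ l * b l * q ^ l)"
proof -
  define D where "D = (\<lambda>q. \<Sum>l. (-1) ^ l * (b (Suc l) - b l) * q ^ l)"
  have nrm: "norm ((-1) ^ l * (b (Suc l) - b l) * q ^ l) \<le> \<bar>b (Suc l) - b l\<bar>"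
    if "q \<in> {0..1}" for l and q :: real
  proof -
    have "\<bar>b (Suc l) - b l\<bar> * q ^ l \<le> \<bar>b (Suc l) - b l\<bar> * 1"
      using that by (intro mult_left_mono power_le_one) auto
    then show ?thesis using that by (simp add: abs_mult)
  qed
  have uni: "uniform_limit {0..1} (\<lambda>n q. \<Sum>l<n. (-1) ^ l * (b (Suc l) - b l) * q ^ l) D sequentially"
    unfolding D_def using nrm var by (rule Weierstrass_m_test)
  have contD: "continuous_on {0..1} D"
    by (rule uniform_limit_theorem[OF _ uni]) (auto intro!: always_eventually continuous_intros)
  have part: "(1 + q) * (\<Sum>l<N. (-1) ^ l * b l * q ^ l)
      = b 0 - q * (\<Sum>l<N. (-1) ^ l * (b (Suc l) - b l) * q ^ l) - (-1) ^ N * b N * q ^ N" for q :: real and N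
    by (induction N) (auto simp: algebra_simps)
  have sums: "(\<lambda>l. (-1) ^ l * b l * q ^ l) sums ((b 0 - q * D q) / (1 + q))" if q: "q \<in> {0..1}" for q
  proof -
    have "(\<lambda>N. \<Sum>l<N. (-1) ^ l * (b (Suc l) - b l) * q ^ l) \<longlonglongrightarrow> D q"
      using uni q by (rule tendsto_uniform_limitI)
    moreover have "(\<lambda>N. (-1) ^ N * b N * q ^ N) \<longlonglongrightarrow> 0"
    proof (rule Lim_null_comparison[OF _ tendsto_rabs_zero[OF lim]])
      have "\<bar>b N\<bar> * q ^ N \<le> \<bar>b N\<bar> * 1" for N
        using q by (intro mult_left_mono power_le_one) auto
      then show "\<forall>\<^sub>F N in sequentially. norm ((-1) ^ N * b N * q ^ N) \<le> \<bar>b N\<bar>"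
        using q by (intro always_eventually) (simp add: abs_mult)
    qed
    ultimately have "(\<lambda>N. (b 0 - q * (\<Sum>l<N. (-1) ^ l * (b (Suc l) - b l) * q ^ l)
        - (-1) ^ N * b N * q ^ N) / (1 + q)) \<longlonglongrightarrow> (b 0 - q * D q - 0) / (1 + q)"
      using q by (intro tendsto_intros) auto
    moreover have "(\<Sum>l<N. (-1) ^ l * b l * q ^ l)
        = (b 0 - q * (\<Sum>l<N. (-1) ^ l * (b (Suc l) - b l) * q ^ l) - (-1) ^ N * b N * q ^ N) / (1 + q)" for N
      using q by (subst part[symmetric]) auto
    ultimately show ?thesis unfolding sums_def by simp
  qed
  show "summable (\<lambda>l. (-1) ^ l * b l * q ^ l)" if "0 \<le> q" "q \<le> 1"
    using sums[of q] that by (auto simp: sums_iff)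
  have "continuous_on {0..1} (\<lambda>q. (b 0 - q * D q) / (1 + q))"
    by (intro continuous_intros contD) auto
  then show "continuous_on {0..1} (\<lambda>q. \<Sum>l. (-1) ^ l * b l * q ^ l)"
    by (rule continuous_on_eq) (use sums in \<open>auto simp: sums_iff\<close>)
qed

text \<open>Every denominator is at least \<open>Suc l\<close>, so each nested summation costs at
  most one harmonic factor; growth is thus only logarithmic.\<close>

lemma sum_tcoef_le:
  assumes "\<forall>k\<in>set ks. 0 < k"
  shows "(\<Sum>i\<le>l. tcoef ks i) \<le> harm (Suc l) ^ length ks"
    and "ks \<noteq> [] \<Longrightarrow> tcoef ks l \<le> harm (Suc l) ^ (length ks - 1) / real (Suc l)"
proof -
  have step: "tcoef (k # ks) l \<le> harm (Suc l) ^ length ks / real (Suc l)"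
    if "(\<Sum>i\<le>l. tcoef ks i) \<le> harm (Suc l) ^ length ks" "0 < k" for k l ks
  proof -
    have "real (Suc l) \<le> real (Suc (length ks) + 2 * l) ^ 1" by simp
    also have "\<dots> \<le> real (Suc (length ks) + 2 * l) ^ k"
      using that by (intro power_increasing) auto
    finally show ?thesis
      using that by (auto intro!: frac_le simp: harm_nonneg)
  qed
  have A: "(\<Sum>i\<le>l. tcoef ks i) \<le> harm (Suc l) ^ length ks" if "\<forall>k\<in>set ks. 0 < k" for ks l
    using that
  proof (induction ks arbitrary: l)
    case (Cons k ks)
    have "(\<Sum>i\<le>l. tcoef (k # ks) i) \<le> (\<Sum>i\<le>l. harm (Suc l) ^ length ks / real (Suc i))"
    proof (rule sum_mono)
      fix i assume i: "i \<in> {..l}"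
      have "tcoef (k # ks) i \<le> harm (Suc i) ^ length ks / real (Suc i)"
        using Cons by (intro step) auto
      also have "\<dots> \<le> harm (Suc l) ^ length ks / real (Suc i)"
        using i by (intro divide_right_mono power_mono harm_mono harm_nonneg) auto
      finally show "tcoef (k # ks) i \<le> harm (Suc l) ^ length ks / real (Suc i)" .
    qed
    also have "\<dots> = harm (Suc l) ^ length ks * (\<Sum>i\<le>l. inverse (real (Suc i)))"
      by (simp add: sum_distrib_left divide_inverse)
    also have "(\<Sum>i\<le>l. inverse (real (Suc i))) = harm (Suc l)"
      unfolding harm_def by (rule sum.reindex_bij_witness[of _ "\<lambda>i. i - 1" Suc]) auto
    finally show ?case by (simp add: mult.commute)
  qed simp
  show "(\<Sum>i\<le>l. tcoef ks i) \<le> harm (Suc l) ^ length ks" using assms by (rule A)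
  show "tcoef ks l \<le> harm (Suc l) ^ (length ks - 1) / real (Suc l)" if "ks \<noteq> []"
    using that assms A step by (cases ks) auto
qed

text \<open>The square root is a convenient bound for powers of logarithms: divided by the square of
  \<open>l\<close> it leaves the summable exponent -3/2.\<close>

lemma harm_power_le_sqrt: "\<forall>\<^sub>F n in sequentially. harm (Suc (Suc n)) ^ r \<le> sqrt (real (Suc n))"
proof -
  have "(\<lambda>n. (ln (real (Suc (Suc n))) + 1) ^ r / sqrt (real (Suc n))) \<longlonglongrightarrow> 0"
    by real_asymp
  then have "\<forall>\<^sub>F n in sequentially. (ln (real (Suc (Suc n))) + 1) ^ r / sqrt (real (Suc n)) < 1"
    by (rule order_tendstoD) simp
  then show ?thesis
  proof eventually_elim
    case (elim n)
    \<comment> \<open>The difference of \<open>harm\<close> and \<open>ln\<close> is decreasing and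
      starts at 1.\<close>
    have "harm (Suc (Suc n)) - ln (real (Suc (Suc n))) \<le> (1 :: real)"
      using decseqD[OF decseq_harm_diff_ln, of 0 "Suc n"] by (simp add: harm_def)
    then have "harm (Suc (Suc n)) ^ r \<le> (ln (real (Suc (Suc n))) + 1) ^ r"
      by (intro power_mono harm_nonneg) auto
    with elim show ?case by (simp add: divide_simps)
  qed
qed

text \<open>A step in \<open>l\<close> adds one summand to the numerator and enlarges the
  denominator. Each effect is at most a constant times a power of a harmonic number over the square
  of \<open>l\<close>.\<close>

lemma tcoef_bounded_variation:
  assumes "\<forall>k\<in>set ks. 0 < k"
  shows "tcoef ks \<longlonglongrightarrow> 0" "summable (\<lambda>l. \<bar>tcoef ks (Suc l) - tcoef ks l\<bar>)"
proof -
  have "tcoef ks \<longlonglongrightarrow> 0 \<and> summable (\<lambda>l. \<bar>tcoef ks (Suc l) - tcoef ks l\<bar>)"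
  proof (cases ks)
    case Nil
    have "(\<lambda>l. tcoef [] (Suc l)) \<longlonglongrightarrow> 0" by simp
    then have "tcoef [] \<longlonglongrightarrow> 0" by (rule LIMSEQ_imp_Suc)
    moreover have "summable (\<lambda>l. \<bar>tcoef [] (Suc l) - tcoef [] l\<bar>)"
      by (rule summable_finite[of "{0}"]) auto
    ultimately show ?thesis using Nil by simp
  next
    case (Cons k js)
    define r where "r = length js"
    define S where "S = (\<lambda>l. \<Sum>i\<le>l. tcoef js i)"
    have js: "\<forall>k\<in>set js. 0 < k" "0 < k" using assms Cons by auto
    have tc: "tcoef ks l = S l / real (Suc r + 2 * l) ^ k" for l
      unfolding Cons S_def r_def by simp
    have S0: "0 \<le> S l" for l unfolding S_def by (intro sum_nonneg tcoef_nonneg)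
    have hm: "harm (Suc l) \<le> (harm (Suc (Suc l)) :: real)" for l
      by (rule harm_mono) simp
    have h1: "(1::real) \<le> harm (Suc l)" for l
      using harm_mono[of 1 "Suc l", where ?'a = real] by (simp add: harm_def)
    have S_le: "S l \<le> harm (Suc (Suc l)) ^ r" for l
      using sum_tcoef_le(1)[OF js(1), of l] power_mono[OF hm harm_nonneg, of l r]
      unfolding S_def r_def by linarith
    \<comment> \<open>The bound is weakened so that the same harmonic power serves here and in
      \<open>S_le\<close>, and so that \<open>js = []\<close> is included.\<close>
    have js_le: "tcoef js (Suc l) \<le> harm (Suc (Suc l)) ^ r / real (Suc l)" for l
    proof (cases "js = []")
      case False
      have "tcoef js (Suc l) \<le> harm (Suc (Suc l)) ^ (r - 1) / real (Suc (Suc l))"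
        using sum_tcoef_le(2)[OF js(1) False, of "Suc l"] by (simp add: r_def)
      also have "\<dots> \<le> harm (Suc (Suc l)) ^ r / real (Suc l)"
        using h1[of "Suc l"] by (intro frac_le power_increasing) auto
      finally show ?thesis .
    qed (auto simp: harm_nonneg)
    have ev: "\<forall>\<^sub>F l in sequentially. harm (Suc (Suc l)) ^ r \<le> sqrt (real (Suc l))"
      by (rule harm_power_le_sqrt)
    have "tcoef ks \<longlonglongrightarrow> 0"
    proof (rule Lim_null_comparison)
      show "\<forall>\<^sub>F l in sequentially. norm (tcoef ks l) \<le> sqrt (real (Suc l)) / real (Suc l)"
        using ev
      proof eventually_elim
        case (elim l)
        have "tcoef ks l \<le> harm (Suc l) ^ r / real (Suc l)"
          using sum_tcoef_le(2)[OF assms, of l] by (simp add: Cons r_def)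
        also have "\<dots> \<le> sqrt (real (Suc l)) / real (Suc l)"
          using elim power_mono[OF hm harm_nonneg, of l r] by (intro divide_right_mono) auto
        finally show ?case using tcoef_nonneg[of ks l] by simp
      qed
      show "(\<lambda>l. sqrt (real (Suc l)) / real (Suc l)) \<longlonglongrightarrow> 0" by real_asymp
    qed
    moreover have "summable (\<lambda>l. \<bar>tcoef ks (Suc l) - tcoef ks l\<bar>)"
    proof (rule summable_comparison_test_ev)
      have "summable (\<lambda>l. real l powr (-3/2))"
        by (subst summable_real_powr_iff) simp
      then have "summable (\<lambda>l. real (Suc l) powr (-3/2))"
        by (subst summable_Suc_iff)
      then show "summable (\<lambda>l. (1 + 2 * real k) * real (Suc l) powr (-3/2))"
        by (rule summable_mult)
      show "\<forall>\<^sub>F l in sequentially. norm \<bar>tcoef ks (Suc l) - tcoef ks l\<bar>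
          \<le> (1 + 2 * real k) * real (Suc l) powr (-3/2)"
        using ev
      proof eventually_elim
        case (elim l)
        define x where "x = real (Suc r + 2 * l)"
        have x: "real (Suc l) \<le> x" "1 \<le> x" by (simp_all add: x_def)
        have x2: "real (Suc r + 2 * Suc l) = x + 2" by (simp add: x_def)
        define H where "H = (harm (Suc (Suc l)) ^ r :: real)"
        have H: "0 \<le> H" by (simp add: H_def harm_nonneg)
        have "tcoef ks (Suc l) - tcoef ks l
            = tcoef js (Suc l) * (1 / (x + 2)) ^ k - S l * ((1 / x) ^ k - (1 / (x + 2)) ^ k)"
          unfolding tc x2 x_def[symmetric]
          by (simp add: S_def power_divide algebra_simps add_divide_distrib)
        also have "\<bar>\<dots>\<bar> \<le> \<bar>tcoef js (Suc l) * (1 / (x + 2)) ^ k\<bar> + \<bar>S l * ((1 / x) ^ k - (1 / (x + 2)) ^ k)\<bar>"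
          by (rule abs_triangle_ineq4)
        also have "\<bar>tcoef js (Suc l) * (1 / (x + 2)) ^ k\<bar> \<le> H / real (Suc l) * (1 / real (Suc l))"
        proof -
          have "(1 / (x + 2)) ^ k \<le> (1 / (x + 2)) ^ 1"
            using x js by (intro power_decreasing) auto
          also have "\<dots> \<le> 1 / real (Suc l)" using x by (simp add: frac_le)
          finally have "tcoef js (Suc l) * (1 / (x + 2)) ^ k \<le> H / real (Suc l) * (1 / real (Suc l))"
            using js_le[of l] x H by (intro mult_mono) (auto simp: H_def)
          then show ?thesis using x tcoef_nonneg[of js "Suc l"] by (simp add: abs_mult)
        qed
        also have "\<bar>S l * ((1 / x) ^ k - (1 / (x + 2)) ^ k)\<bar> \<le> H * (real k * (2 * (1 / real (Suc l) * (1 / real (Suc l)))))"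
        proof -
          \<comment> \<open>On the unit interval the \<open>k\<close>-th power is Lipschitz with
            constant \<open>k\<close>.\<close>
          have "\<bar>(1 / x) ^ k - (1 / (x + 2)) ^ k\<bar> \<le> real k * \<bar>1 / x - 1 / (x + 2)\<bar>"
            using norm_power_diff[of "1 / x" "1 / (x + 2)" k] x by simp
          also have "\<bar>1 / x - 1 / (x + 2)\<bar> = 2 * (1 / x * (1 / (x + 2)))"
            using x by (simp add: field_simps)
          also have "\<dots> \<le> 2 * (1 / real (Suc l) * (1 / real (Suc l)))"
            using x by (intro mult_left_mono mult_mono divide_left_mono) auto
          finally have "\<bar>(1 / x) ^ k - (1 / (x + 2)) ^ k\<bar> \<le> real k * (2 * (1 / real (Suc l) * (1 / real (Suc l))))"
            by (simp add: mult_left_mono)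
          then show ?thesis
            unfolding abs_mult using S0[of l] S_le[of l] H by (intro mult_mono) (auto simp: H_def)
        qed
        finally have "\<bar>tcoef ks (Suc l) - tcoef ks l\<bar> \<le> (1 + 2 * real k) * (H * (1 / real (Suc l) * (1 / real (Suc l))))"
          by (simp add: algebra_simps add_divide_distrib)
        also have "\<dots> \<le> (1 + 2 * real k) * (sqrt (real (Suc l)) * (1 / real (Suc l) * (1 / real (Suc l))))"
          using elim unfolding H_def by (intro mult_left_mono mult_right_mono) auto
        also have "sqrt (real (Suc l)) * (1 / real (Suc l) * (1 / real (Suc l))) = real (Suc l) powr (1/2 - 1 - 1)"
          by (simp only: powr_diff powr_half_sqrt of_nat_0_le_iff powr_one) simp
        also have "(1/2 - 1 - 1 :: real) = -3/2" by simp
        finally show ?case by simp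
      qed
    qed
    ultimately show ?thesis by simp
  qed
  then show "tcoef ks \<longlonglongrightarrow> 0" "summable (\<lambda>l. \<bar>tcoef ks (Suc l) - tcoef ks l\<bar>)" by auto
qed

lemma wcoef_bounded_variation:
  shows "wcoef r d \<longlonglongrightarrow> 0" "summable (\<lambda>l. \<bar>wcoef r d (Suc l) - wcoef r d l\<bar>)"
proof -
  have pos: "\<forall>k\<in>set ks. 0 < k" if "ks \<in> Icomp (r + d) r" for ks
    using that by (auto simp: Icomp_def)
  have "(\<lambda>l. \<Sum>ks\<in>Icomp (r + d) r. tcoef ks l) \<longlonglongrightarrow> (\<Sum>ks\<in>Icomp (r + d) r. 0)"
    using pos by (intro tendsto_sum tcoef_bounded_variation) auto
  then show "wcoef r d \<longlonglongrightarrow> 0" by (simp add: wcoef_def[abs_def])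
  show "summable (\<lambda>l. \<bar>wcoef r d (Suc l) - wcoef r d l\<bar>)"
  proof (rule summable_comparison_test')
    show "summable (\<lambda>l. \<Sum>ks\<in>Icomp (r + d) r. \<bar>tcoef ks (Suc l) - tcoef ks l\<bar>)"
      using pos by (intro summable_sum tcoef_bounded_variation) auto
    show "norm \<bar>wcoef r d (Suc l) - wcoef r d l\<bar>
        \<le> (\<Sum>ks\<in>Icomp (r + d) r. \<bar>tcoef ks (Suc l) - tcoef ks l\<bar>)" for l
      unfolding wcoef_def by (simp flip: sum_subtractf)
  qed
qed

section \<open>Generating functions and their differential equation\<close>

definition wser :: "nat \<Rightarrow> nat \<Rightarrow> real \<Rightarrow> real" where
  "wser r d q = (\<Sum>l. (-1) ^ l * wcoef r d l * q ^ l)"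

text \<open>Termwise this is
  \<open>2 ^ r * (-1) ^ l * wcoef r d l * exp (- (r + 2 * l) * z)\<close>. The exponent contains
  exactly the outermost denominator \<open>r + 2 * l\<close>, so that differentiation in
  \<open>z\<close> removes one power of it.\<close>

definition wfun :: "nat \<Rightarrow> nat \<Rightarrow> real \<Rightarrow> real" where
  "wfun r d z = 2 ^ r * exp (- real r * z) * wser r d (exp (- 2 * z))"

lemma W_eq_wfun:
  assumes "0 < r"
  shows "W (r + d) r = (-1) ^ r * wfun r d 0"
proof -
  have "W (r + d) r = (-2) ^ r * (\<Sum>l. (-1) ^ l * wcoef r d l)"
  proof (rule W_eq[OF assms])
    fix ks assume "ks \<in> Icomp (r + d) r"
    then have "\<forall>k\<in>set ks. 0 < k" by (auto simp: Icomp_def)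
    from summable_alternating_powser[OF tcoef_bounded_variation[OF this], of 1]
    show "summable (\<lambda>l. (-1) ^ l * tcoef ks l)" by simp
  qed
  then show ?thesis by (simp add: wfun_def wser_def flip: power_mult_distrib mult.assoc)
qed

lemma wfun_0: "wfun 0 d z = of_bool (d = 0)"
proof -
  have "(\<lambda>l. (-1) ^ l * wcoef 0 d l * exp (- 2 * z) ^ l) sums
      ((-1) ^ 0 * wcoef 0 d 0 * exp (- 2 * z) ^ 0)"
    by (rule sums_finite[of "{0}", simplified sum.insert_if, simplified]) (auto simp: wcoef_0)
  then show ?thesis by (simp add: wfun_def wser_def sums_iff wcoef_0)
qed

text \<open>The point \<open>z = 0\<close> is included; it corresponds to \<open>q = 1\<close>,
  where continuity is of the kind given by Abel's theorem.\<close>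

lemma continuous_on_wfun: "continuous_on {0..} (wfun r d)"
proof -
  have "continuous_on {0..} (\<lambda>z. wser r d (exp (- 2 * z)))"
    by (rule continuous_on_compose2[OF
          continuous_on_alternating_powser[OF wcoef_bounded_variation, folded wser_def]])
       (auto intro!: continuous_intros)
  then show ?thesis unfolding wfun_def by (intro continuous_intros)
qed

text \<open>The exponential factor decays while \<open>wser\<close> tends to its value at
  \<open>q = 0\<close>. At depth zero this fails, as \<open>wfun 0 0\<close> is constantly
  1.\<close>

lemma wfun_tendsto_0: "(wfun (Suc r) d \<longlongrightarrow> 0) at_top"
proof -
  have "(wser (Suc r) d \<longlongrightarrow> wser (Suc r) d 0) (at 0 within {0..1})"
    using continuous_on_alternating_powser[OF wcoef_bounded_variation, of "Suc r" d]
    unfolding wser_def[abs_def] continuous_on_def by (rule bspec) simp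
  moreover have "filterlim (\<lambda>z::real. exp (- 2 * z)) (at 0 within {0..1}) at_top"
    unfolding filterlim_at
  proof
    show "\<forall>\<^sub>F z::real in at_top. exp (- 2 * z) \<in> {0..1} \<and> exp (- 2 * z) \<noteq> 0"
      using eventually_ge_at_top[of 0] by eventually_elim auto
    show "((\<lambda>z::real. exp (- 2 * z)) \<longlongrightarrow> 0) at_top" by real_asymp
  qed
  ultimately have "((\<lambda>z. wser (Suc r) d (exp (- 2 * z))) \<longlongrightarrow> wser (Suc r) d 0) at_top"
    by (rule filterlim_compose)
  moreover have "((\<lambda>z::real. 2 ^ Suc r * exp (- real (Suc r) * z)) \<longlongrightarrow> 0) at_top"
    by real_asymp
  ultimately have "((\<lambda>z. 2 ^ Suc r * exp (- real (Suc r) * z) * wser (Suc r) d (exp (- 2 * z))) \<longlongrightarrow> 0 * wser (Suc r) d 0) at_top"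
    by (intro tendsto_mult)
  then show ?thesis by (simp only: wfun_def[abs_def] mult_zero_left)
qed

text \<open>The operator \<open>Suc r + 2 * q * d/dq\<close> multiplies the coefficient of
  \<open>q ^ l\<close> by \<open>Suc r + 2 * l\<close>, so \<open>wcoef_Suc\<close> becomes a
  differential equation. The sum over \<open>i \<le> l\<close> there becomes multiplication by
  \<open>1 / (1 + q)\<close>.\<close>

lemma wser_euler:
  assumes "0 < q" "q < 1"
  shows "\<exists>D. (wser (Suc r) d has_real_derivative D) (at q) \<and>
     real (Suc r) * wser (Suc r) d q + 2 * q * D
       = wser r d q / (1 + q) + (if d = 0 then 0 else wser (Suc r) (d - 1) q)"
proof -
  define c where "c = (\<lambda>r d l. (-1) ^ l * wcoef r d l)"
  have wser: "wser r d q = (\<Sum>l. c r d l * q ^ l)" for r d q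
    by (simp add: wser_def c_def)
  have sm1: "summable (\<lambda>l. c r d l * 1 ^ l)" for r d
    using summable_alternating_powser[OF wcoef_bounded_variation, of 1 r d] by (simp add: c_def)
  \<comment> \<open>Convergence at 1 gives absolute convergence at \<open>q < 1\<close>, which the
    Cauchy product below requires.\<close>
  have absum: "summable (\<lambda>l. norm (c r d l * q ^ l))" for r d
    using assms by (intro powser_insidea[OF sm1]) auto
  then have sm: "summable (\<lambda>l. c r d l * q ^ l)" for r d
    by (rule summable_norm_cancel)
  define D where "D = (\<Sum>l. diffs (c (Suc r) d) l * q ^ l)"
  have der: "(wser (Suc r) d has_real_derivative D) (at q)"
    unfolding D_def wser using assms by (intro termdiffs_strong[OF sm1]) auto
  have "summable (\<lambda>l. diffs (c (Suc r) d) l * q ^ l)"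
  proof (rule termdiff_converges[where K = 1])
    fix x :: real assume "norm x < 1"
    then show "summable (\<lambda>l. c (Suc r) d l * x ^ l)"
      using powser_inside[OF sm1, of x "Suc r" d] by simp
  qed (use assms in auto)
  then have "(\<lambda>l. real l * c (Suc r) d l * q ^ (l - Suc 0)) sums D"
    unfolding D_def by (rule diffs_equiv)
  then have "(\<lambda>l. 2 * q * (real l * c (Suc r) d l * q ^ (l - Suc 0))) sums (2 * q * D)"
    by (rule sums_mult)
  \<comment> \<open>For \<open>l = 0\<close> the exponent \<open>l - Suc 0\<close> is truncated, but
    the factor \<open>real l\<close> vanishes.\<close>
  moreover have "2 * q * (real l * c (Suc r) d l * q ^ (l - Suc 0)) = real (2 * l) * (c (Suc r) d l * q ^ l)" for l
    by (cases l) auto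
  ultimately have "(\<lambda>l. real (2 * l) * (c (Suc r) d l * q ^ l)) sums (2 * q * D)"
    by simp
  moreover have "(\<lambda>l. real (Suc r) * (c (Suc r) d l * q ^ l)) sums (real (Suc r) * wser (Suc r) d q)"
    unfolding wser using sm by (intro sums_mult summable_sums)
  ultimately have "(\<lambda>l. real (Suc r) * (c (Suc r) d l * q ^ l) + real (2 * l) * (c (Suc r) d l * q ^ l))
      sums (real (Suc r) * wser (Suc r) d q + 2 * q * D)"
    by (intro sums_add)
  moreover have "real (Suc r) * (c (Suc r) d l * q ^ l) + real (2 * l) * (c (Suc r) d l * q ^ l)
      = (\<Sum>i\<le>l. c r d i * q ^ i * (- q) ^ (l - i)) + (if d = 0 then 0 else c (Suc r) (d - 1) l * q ^ l)" for l
  proof -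
    have "real (Suc r) * (c (Suc r) d l * q ^ l) + real (2 * l) * (c (Suc r) d l * q ^ l)
        = (-1) ^ l * q ^ l * (real (Suc r + 2 * l) * wcoef (Suc r) d l)"
      by (simp add: c_def algebra_simps)
    also have "\<dots> = (\<Sum>i\<le>l. (-1) ^ l * q ^ l * wcoef r d i) + (if d = 0 then 0 else c (Suc r) (d - 1) l * q ^ l)"
      unfolding wcoef_Suc by (simp add: c_def algebra_simps sum_distrib_left)
    \<comment> \<open>Distributing the sign over \<open>i\<close> and \<open>l - i\<close> exhibits
      a Cauchy product with the geometric series of \<open>- q\<close>.\<close>
    also have "(\<Sum>i\<le>l. (-1) ^ l * q ^ l * wcoef r d i) = (\<Sum>i\<le>l. c r d i * q ^ i * (- q) ^ (l - i))"
    proof (rule sum.cong[OF refl])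
      fix i assume "i \<in> {..l}"
      then have "(- q) ^ l = (- q) ^ i * (- q) ^ (l - i)" by (simp flip: power_add)
      moreover have "(- q) ^ n = (-1) ^ n * q ^ n" for n by (rule power_minus)
      ultimately show "(-1) ^ l * q ^ l * wcoef r d i = c r d i * q ^ i * (- q) ^ (l - i)"
        by (simp add: c_def mult_ac)
    qed
    finally show ?thesis .
  qed
  ultimately have "(\<lambda>l. (\<Sum>i\<le>l. c r d i * q ^ i * (- q) ^ (l - i)) + (if d = 0 then 0 else c (Suc r) (d - 1) l * q ^ l))
      sums (real (Suc r) * wser (Suc r) d q + 2 * q * D)" by simp
  moreover have "(\<lambda>l. (\<Sum>i\<le>l. c r d i * q ^ i * (- q) ^ (l - i)) + (if d = 0 then 0 else c (Suc r) (d - 1) l * q ^ l))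
      sums (wser r d q * (1 / (1 - (- q))) + (if d = 0 then 0 else wser (Suc r) (d - 1) q))"
  proof (rule sums_add)
    have "summable (\<lambda>l. norm ((- q) ^ l))"
      using assms by (simp add: norm_power summable_geometric)
    from Cauchy_product_sums[OF absum this]
    show "(\<lambda>l. \<Sum>i\<le>l. c r d i * q ^ i * (- q) ^ (l - i)) sums (wser r d q * (1 / (1 - (- q))))"
      using assms by (subst (asm) suminf_geometric) (auto simp: wser)
    show "(\<lambda>l. if d = 0 then 0 else c (Suc r) (d - 1) l * q ^ l) sums (if d = 0 then 0 else wser (Suc r) (d - 1) q)"
      unfolding wser using sm by (auto intro: summable_sums)
  qed
  ultimately have "real (Suc r) * wser (Suc r) d q + 2 * q * D
      = wser r d q * (1 / (1 - (- q))) + (if d = 0 then 0 else wser (Suc r) (d - 1) q)"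
    by (rule sums_unique2)
  then show ?thesis using der by (intro exI[of _ D]) simp
qed

text \<open>Under \<open>q = exp (- 2 * z)\<close> the operator of \<open>wser_euler\<close> becomes
  \<open>- d/dz\<close>, and \<open>2 * exp (- z) / (1 + q) = 1 / cosh z\<close>. Positivity of
  \<open>z\<close> keeps \<open>q\<close> inside the disc of convergence.\<close>

lemma DERIV_wfun:
  assumes "0 < z"
  shows "(wfun (Suc r) d has_real_derivative
     - ((if d = 0 then 0 else wfun (Suc r) (d - 1) z) + wfun r d z / cosh z)) (at z)"
proof -
  define q where "q = exp (- 2 * z)"
  have q: "0 < q" "q < 1" using assms by (auto simp: q_def)
  obtain D where D: "(wser (Suc r) d has_real_derivative D) (at q)"
    and eq: "real (Suc r) * wser (Suc r) d q + 2 * q * D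
       = wser r d q / (1 + q) + (if d = 0 then 0 else wser (Suc r) (d - 1) q)"
    using wser_euler[OF q] by blast
  define E where "E = 2 ^ Suc r * exp (- real (Suc r) * z)"
  have "(wfun (Suc r) d has_real_derivative
      (2 ^ Suc r * (exp (- real (Suc r) * z) * (- real (Suc r)))) * wser (Suc r) d q
      + E * (D * (exp (- 2 * z) * (- 2)))) (at z)"
  proof -
    have "((\<lambda>z. wser (Suc r) d (exp (- 2 * z))) has_real_derivative D * (exp (- 2 * z) * (- 2))) (at z)"
      by (rule DERIV_chain2[where f = "wser (Suc r) d" and g = "\<lambda>z. exp (- 2 * z)"])
         (use D in \<open>auto intro!: derivative_eq_intros simp: q_def\<close>)
    moreover have "((\<lambda>z. 2 ^ Suc r * exp (- real (Suc r) * z)) has_real_derivative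
        2 ^ Suc r * (exp (- real (Suc r) * z) * (- real (Suc r)))) (at z)"
      by (auto intro!: derivative_eq_intros)
    ultimately have "((\<lambda>z. 2 ^ Suc r * exp (- real (Suc r) * z) * wser (Suc r) d (exp (- 2 * z)))
        has_real_derivative 2 ^ Suc r * (exp (- real (Suc r) * z) * (- real (Suc r))) * wser (Suc r) d (exp (- 2 * z))
         + D * (exp (- 2 * z) * (- 2)) * (2 ^ Suc r * exp (- real (Suc r) * z))) (at z)"
      by (rule DERIV_mult[rotated])
    then show ?thesis
      unfolding wfun_def[abs_def] E_def q_def by (simp only: mult_ac)
  qed
  also have "(2 ^ Suc r * (exp (- real (Suc r) * z) * (- real (Suc r)))) * wser (Suc r) d q
      + E * (D * (exp (- 2 * z) * (- 2))) = - (E * (real (Suc r) * wser (Suc r) d q + 2 * q * D))"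
    by (simp add: E_def q_def algebra_simps)
  also have "E * (real (Suc r) * wser (Suc r) d q + 2 * q * D)
      = (if d = 0 then 0 else wfun (Suc r) (d - 1) z) + E / (1 + q) * wser r d q"
    unfolding eq by (simp add: E_def wfun_def q_def algebra_simps)
  also have "E / (1 + q) * wser r d q = wfun r d z / cosh z"
  proof -
    have "E = 2 ^ r * exp (- real r * z) * (2 * exp (- z))"
      by (simp add: E_def algebra_simps exp_diff exp_minus field_simps flip: exp_add)
    moreover have "1 + q = 2 * exp (- z) * cosh z"
      by (simp add: cosh_field_def q_def algebra_simps flip: exp_add)
    ultimately have "E / (1 + q) = 2 ^ r * exp (- real r * z) / cosh z" by simp
    then show ?thesis by (simp add: wfun_def q_def)
  qed
  finally show ?thesis .
qed

section \<open>Integral representation of W\<close>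

definition dpow :: "nat \<Rightarrow> real \<Rightarrow> real" where
  "dpow n x = x ^ n / fact n"

text \<open>The derivative of \<open>dpow n\<close>; order 0 is separate because
  \<open>n - 1\<close> is truncated.\<close>

definition dpow' :: "nat \<Rightarrow> real \<Rightarrow> real" where
  "dpow' n x = (if n = 0 then 0 else dpow (n - 1) x)"

lemma DERIV_dpow [THEN DERIV_chain2, derivative_intros]:
  "(dpow n has_real_derivative dpow' n x) (at x)"
  using DERIV_divided_power[of "n - 1" x] by (cases n) (auto simp: dpow_def[abs_def] dpow'_def)

lemma dpow_nonneg: "0 \<le> x \<Longrightarrow> 0 \<le> dpow n x"
  by (simp add: dpow_def)

lemma dpow'_nonneg: "0 \<le> x \<Longrightarrow> 0 \<le> dpow' n x"
  by (simp add: dpow'_def dpow_def)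

lemma dpow_mono: "0 \<le> x \<Longrightarrow> x \<le> y \<Longrightarrow> dpow n x \<le> dpow n y"
  by (simp add: dpow_def divide_right_mono power_mono)

lemma borel_measurable_dpow [measurable]: "dpow n \<in> borel_measurable borel"
  unfolding dpow_def[abs_def] by measurable

lemma borel_measurable_dpow' [measurable]: "dpow' n \<in> borel_measurable borel"
  by (cases n) (simp_all add: dpow'_def[abs_def])

text \<open>Solving the recursion by iterated integration takes \<open>d\<close> steps with
  \<open>dy\<close> and \<open>r\<close> steps with \<open>dy / cosh y = d (gd y)\<close>,
  interleaved in all orders. Summing over the orders gives the product of the two divided powers;
  the last step contributes \<open>1 / cosh v\<close>.\<close>

definition kern :: "nat \<Rightarrow> nat \<Rightarrow> real \<Rightarrow> real \<Rightarrow> real" where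
  "kern r d z v = dpow d (v - z) * dpow r (gd v - gd z) / cosh v"

definition kern' :: "nat \<Rightarrow> nat \<Rightarrow> real \<Rightarrow> real \<Rightarrow> real" where
  "kern' r d z v = (dpow' d (v - z) * dpow r (gd v - gd z)
     + dpow d (v - z) * dpow' r (gd v - gd z) / cosh z) / cosh v"

lemma borel_measurable_kern [measurable (raw)]:
  assumes [measurable]: "f \<in> borel_measurable M" "g \<in> borel_measurable M"
  shows "(\<lambda>x. kern r d (f x) (g x)) \<in> borel_measurable M"
  unfolding kern_def by measurable

lemma borel_measurable_kern' [measurable (raw)]:
  assumes [measurable]: "f \<in> borel_measurable M" "g \<in> borel_measurable M"
  shows "(\<lambda>x. kern' r d (f x) (g x)) \<in> borel_measurable M"
  unfolding kern'_def by measurable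

lemma kern_nonneg: "z \<le> v \<Longrightarrow> 0 \<le> kern r d z v"
  unfolding kern_def by (auto intro!: mult_nonneg_nonneg divide_nonneg_nonneg dpow_nonneg gd_mono)

lemma kern'_nonneg: "z \<le> v \<Longrightarrow> 0 \<le> kern' r d z v"
  unfolding kern'_def
  by (auto intro!: mult_nonneg_nonneg divide_nonneg_nonneg add_nonneg_nonneg dpow_nonneg dpow'_nonneg gd_mono)

lemma kern_antimono:
  assumes "z' \<le> z" "z \<le> v"
  shows "kern r d z v \<le> kern r d z' v"
  unfolding kern_def using assms gd_mono[OF assms(1)] gd_mono[OF assms(2)]
  by (intro divide_right_mono mult_mono dpow_mono dpow_nonneg) auto

lemma DERIV_kern: "((\<lambda>y. kern r d y v) has_real_derivative - kern' r d y v) (at y)"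
  unfolding kern_def kern'_def
  by (auto intro!: derivative_eq_intros) (simp add: algebra_simps add_divide_distrib diff_divide_distrib)

definition kint :: "nat \<Rightarrow> nat \<Rightarrow> real \<Rightarrow> ennreal" where
  "kint r d z = (\<integral>\<^sup>+v\<in>{z..}. kern r d z v \<partial>lborel)"

text \<open>Since \<open>r + d\<close> is positive, \<open>kern\<close> vanishes on the diagonal and
  is the integral of \<open>kern'\<close> from \<open>z\<close> to \<open>v\<close>. Exchanging the
  integrals over the triangle leaves the two terms of the product rule. This is the integrated form
  of \<open>DERIV_wfun\<close>, with the depth shifted by one.\<close>

lemma kint_rec:
  assumes "0 < r + d"
  shows "kint r d z = (\<integral>\<^sup>+y\<in>{z..}. (if d = 0 then 0 else kint r (d - 1) y)
     + (if r = 0 then 0 else kint (r - 1) d y) / cosh y \<partial>lborel)"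
proof -
  have inner: "(\<integral>\<^sup>+v\<in>{y..}. kern' r d y v \<partial>lborel)
      = (if d = 0 then 0 else kint r (d - 1) y) + (if r = 0 then 0 else kint (r - 1) d y) / cosh y" for y
  proof -
    \<comment> \<open>The zero cases keep the truncated indices \<open>d - 1\<close> and
      \<open>r - 1\<close> out of the integrals.\<close>
    define f g where "f = (\<lambda>v. if d = 0 then 0 else kern r (d - 1) y v)"
      and "g = (\<lambda>v. if r = 0 then 0 else kern (r - 1) d y v)"
    have [measurable]: "f \<in> borel_measurable borel" "g \<in> borel_measurable borel"
      by (cases "d = 0"; cases "r = 0"; simp add: f_def g_def)+
    have fg: "kern' r d y v = f v + g v / cosh y" "0 \<le> f v" "0 \<le> g v" if "y \<le> v" for v
      using kern_nonneg[OF that]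
      by (auto simp: kern'_def kern_def dpow'_def f_def g_def add_divide_distrib)
    have "(\<integral>\<^sup>+v\<in>{y..}. kern' r d y v \<partial>lborel)
        = (\<integral>\<^sup>+v. ennreal (f v) * indicator {y..} v + inverse (ennreal (cosh y)) * (ennreal (g v) * indicator {y..} v) \<partial>lborel)"
      by (rule nn_integral_cong)
         (auto simp: indicator_def fg ennreal_plus divide_ennreal[symmetric] divide_ennreal_def mult.commute)
    also have "\<dots> = (\<integral>\<^sup>+v\<in>{y..}. f v \<partial>lborel) + inverse (ennreal (cosh y)) * (\<integral>\<^sup>+v\<in>{y..}. g v \<partial>lborel)"
      by (subst nn_integral_add, measurable, subst nn_integral_cmult, measurable)
    also have "\<dots> = (if d = 0 then 0 else kint r (d - 1) y) + (if r = 0 then 0 else kint (r - 1) d y) / cosh y"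
      by (simp add: f_def g_def kint_def divide_ennreal_def mult.commute)
    finally show ?thesis .
  qed
  have "kint r d z = (\<integral>\<^sup>+v\<in>{z..}. (\<integral>\<^sup>+y\<in>{z..v}. kern' r d y v \<partial>lborel) \<partial>lborel)"
    unfolding kint_def
  proof (rule nn_integral_cong)
    fix v :: real
    have "ennreal (kern r d z v) = (\<integral>\<^sup>+y\<in>{z..v}. kern' r d y v \<partial>lborel)" if "z \<le> v"
    proof -
      have "(\<integral>\<^sup>+y\<in>{z..v}. kern' r d y v \<partial>lborel) = ennreal ((- kern r d v v) - (- kern r d z v))"
        using that
        by (intro nn_integral_FTC_Icc[where F = "\<lambda>y. - kern r d y v"])
           (auto intro: kern'_nonneg DERIV_minus[OF DERIV_kern, simplified])
      moreover have "kern r d v v = 0" using assms by (auto simp: kern_def dpow_def)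
      ultimately show ?thesis by simp
    qed
    then show "ennreal (kern r d z v) * indicator {z..} v
        = (\<integral>\<^sup>+y\<in>{z..v}. kern' r d y v \<partial>lborel) * indicator {z..} v"
      by (auto simp: indicator_def)
  qed
  also have "\<dots> = (\<integral>\<^sup>+y\<in>{z..}. (\<integral>\<^sup>+v\<in>{y..}. kern' r d y v \<partial>lborel) \<partial>lborel)"
    by (rule nn_integral_triangle[symmetric]) measurable
  also have "\<dots> = (\<integral>\<^sup>+y\<in>{z..}. (if d = 0 then 0 else kint r (d - 1) y)
     + (if r = 0 then 0 else kint (r - 1) d y) / cosh y \<partial>lborel)"
    by (simp only: inner)
  finally show ?thesis .
qed

text \<open>Induction on \<open>r + d\<close>: by \<open>DERIV_wfun\<close> and the limit 0 at
  infinity, \<open>wfun\<close> is the integral over the half line of the same expression as in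
  \<open>kint_rec\<close>.\<close>

lemma wfun_eq_kint:
  assumes "0 < z"
  shows "0 \<le> wfun (Suc r) d z \<and> ennreal (wfun (Suc r) d z) = kint r d z"
  using assms
proof (induction "r + d" arbitrary: r d z rule: less_induct)
  case less
  define f where "f = (\<lambda>y. (if d = 0 then 0 else wfun (Suc r) (d - 1) y) + wfun r d y / cosh y)"
  have A: "0 \<le> wfun (Suc r) (d - 1) y \<and> ennreal (wfun (Suc r) (d - 1) y) = kint r (d - 1) y"
    if "d \<noteq> 0" "0 < y" for y
    using that by (intro less.hyps) auto
  have B: "0 \<le> wfun r d y \<and> ennreal (wfun r d y) = (if r = 0 then of_bool (d = 0) else kint (r - 1) d y)"
    if "0 < y" for y
    using that less.hyps[of "r - 1" d y] by (cases r) (auto simp: wfun_0)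
  have f0: "0 \<le> f y" if "0 < y" for y
    using A B that by (auto simp: f_def)
  have contf: "continuous_on {z..} f"
    unfolding f_def using \<open>0 < z\<close>
    by (cases "d = 0") (auto intro!: continuous_intros continuous_on_subset[OF continuous_on_wfun])
  \<comment> \<open>Freezing \<open>f\<close> to the left of \<open>z\<close> makes it continuous,
    hence measurable, on the whole line.\<close>
  define g where "g = (\<lambda>y. f (max z y))"
  have [measurable]: "g \<in> borel_measurable borel"
    unfolding g_def
    by (intro borel_measurable_continuous_onI continuous_on_compose2[OF contf] continuous_intros) auto
  have der: "(wfun (Suc r) d has_real_derivative - g y) (at y)" if "z \<le> y" for y
    using DERIV_wfun[of y r d] that \<open>0 < z\<close> by (simp only: g_def f_def max_absorb2)
  have g0: "0 \<le> g y" if "z \<le> y" for y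
    using f0[of "max z y"] \<open>0 < z\<close> by (simp add: g_def)
  have "(\<integral>\<^sup>+y\<in>{z..}. g y \<partial>lborel) = ennreal (wfun (Suc r) d z)" "0 \<le> wfun (Suc r) d z"
    using nn_integral_tail[of g z "wfun (Suc r) d", OF _ der g0 wfun_tendsto_0]
      tail_nonneg[of g z "wfun (Suc r) d", OF _ der g0 wfun_tendsto_0] by auto
  moreover have "(\<integral>\<^sup>+y\<in>{z..}. g y \<partial>lborel) = kint r d z"
  proof (cases "r + d = 0")
    case True
    then show ?thesis unfolding kint_def
      by (intro nn_integral_cong) (auto simp: g_def f_def wfun_0 kern_def dpow_def indicator_def)
  next
    case False
    have "ennreal (g y) = (if d = 0 then 0 else kint r (d - 1) y)
        + (if r = 0 then 0 else kint (r - 1) d y) / cosh y" if "z \<le> y" for y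
    proof -
      have y: "0 < y" "max z y = y" using that \<open>0 < z\<close> by auto
      have "ennreal (g y) = ennreal (if d = 0 then 0 else wfun (Suc r) (d - 1) y) + ennreal (wfun r d y) / ennreal (cosh y)"
      proof -
        have "ennreal (a + b / cosh y) = ennreal a + ennreal b / ennreal (cosh y)"
          if "0 \<le> a" "0 \<le> b" for a b
          using that by (simp add: ennreal_plus divide_ennreal)
        moreover have "0 \<le> (if d = 0 then 0 else wfun (Suc r) (d - 1) y)" "0 \<le> wfun r d y"
          using A B y by auto
        ultimately show ?thesis
          unfolding g_def f_def y(2) by blast
      qed
      then show ?thesis using A B y False by auto
    qed
    then have "(\<integral>\<^sup>+y\<in>{z..}. g y \<partial>lborel) = (\<integral>\<^sup>+y\<in>{z..}. (if d = 0 then 0 else kint r (d - 1) y)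
        + (if r = 0 then 0 else kint (r - 1) d y) / cosh y \<partial>lborel)"
      by (intro nn_integral_cong) (auto simp: indicator_def)
    then show ?thesis using False by (simp add: kint_rec)
  qed
  ultimately show ?case by simp
qed

text \<open>Limit \<open>z\<close> to 0 along \<open>1 / real (Suc n)\<close>: the left side
  converges by continuity at 0, the right side by monotone convergence, because both the kernel and
  the domain grow as \<open>z\<close> decreases.\<close>

lemma wfun_0_eq_kint: "0 \<le> wfun (Suc r) d 0 \<and> ennreal (wfun (Suc r) d 0) = kint r d 0"
proof -
  define z where "z = (\<lambda>n. 1 / real (Suc n))"
  have z: "0 < z n" for n by (simp add: z_def)
  have zdec: "z n \<le> z m" if "m \<le> n" for m n
    using that by (simp add: z_def frac_le)
  have zlim: "z \<longlonglongrightarrow> 0" unfolding z_def by real_asymp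
  have lim: "(\<lambda>n. wfun (Suc r) d (z n)) \<longlonglongrightarrow> wfun (Suc r) d 0"
    using z by (intro continuous_on_tendsto_compose[OF continuous_on_wfun zlim])
      (auto intro!: always_eventually less_imp_le)
  have "(\<lambda>n. \<integral>\<^sup>+v. ennreal (kern r d (z n) v) * indicator {z n..} v \<partial>lborel)
      \<longlonglongrightarrow> (\<integral>\<^sup>+v. ennreal (kern r d 0 v) * indicator {0<..} v \<partial>lborel)"
  proof (rule nn_integral_LIMSEQ)
    show "incseq (\<lambda>n v. ennreal (kern r d (z n) v) * indicator {z n..} v)"
    proof (intro monoI le_funI)
      fix m n :: nat and v :: real assume "m \<le> n"
      then show "ennreal (kern r d (z m) v) * indicator {z m..} v \<le> ennreal (kern r d (z n) v) * indicator {z n..} v"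
        using zdec[of m n] by (auto simp: indicator_def intro!: ennreal_leI kern_antimono)
    qed
    fix v :: real
    show "(\<lambda>n. ennreal (kern r d (z n) v) * indicator {z n..} v) \<longlonglongrightarrow> ennreal (kern r d 0 v) * indicator {0<..} v"
    proof (cases "0 < v")
      case True
      have "isCont (\<lambda>y. kern r d y v) 0" using DERIV_kern by (rule DERIV_isCont)
      then have "(\<lambda>n. ennreal (kern r d (z n) v)) \<longlonglongrightarrow> ennreal (kern r d 0 v)"
        by (intro tendsto_ennrealI isCont_tendsto_compose[OF _ zlim])
      moreover have "\<forall>\<^sub>F n in sequentially. z n < v"
        using zlim True by (rule order_tendstoD)
      then have "\<forall>\<^sub>F n in sequentially. ennreal (kern r d (z n) v) = ennreal (kern r d (z n) v) * indicator {z n..} v"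
        by eventually_elim auto
      ultimately show ?thesis using True by (auto elim: Lim_transform_eventually)
    next
      case False
      then have "v \<notin> {z n..}" for n using z[of n] by auto
      then show ?thesis using False by simp
    qed
  qed measurable
  moreover have "(\<integral>\<^sup>+v. ennreal (kern r d 0 v) * indicator {0<..} v \<partial>lborel) = kint r d 0"
    unfolding kint_def
  proof (rule nn_integral_cong_AE)
    show "AE v in lborel. ennreal (kern r d 0 v) * indicator {0<..} v = ennreal (kern r d 0 v) * indicator {0..} v"
      using AE_lborel_singleton[of 0] by eventually_elim (auto simp: indicator_def)
  qed
  ultimately have "(\<lambda>n. ennreal (wfun (Suc r) d (z n))) \<longlonglongrightarrow> kint r d 0"
    using wfun_eq_kint[OF z] by (simp add: kint_def)
  moreover have "(\<lambda>n. ennreal (wfun (Suc r) d (z n))) \<longlonglongrightarrow> ennreal (wfun (Suc r) d 0)"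
    using lim by (rule tendsto_ennrealI)
  moreover have "0 \<le> wfun (Suc r) d 0"
    using wfun_eq_kint[OF z] by (intro tendsto_lowerbound[OF lim]) auto
  ultimately show ?thesis using LIMSEQ_unique by blast
qed

section \<open>The symmetric double integral and the conclusion\<close>

text \<open>The signs in the sum call for Bochner integrals, which exist because each
  \<open>wfun\<close> value is finite. The combined integrand contains
  \<open>angle_poly m (gd v)\<close>, a nonnegative moment of the kernel, so the result can be read
  as a double integral in \<open>ennreal\<close>.\<close>

lemma zcoef_wfun_integral:
  fixes m j :: nat
  defines "Y \<equiv> \<Sum>i\<le>m. zcoef (m - i) * ((-1) ^ i * wfun (2 * i + 1) (2 * j) 0)"
  shows "0 \<le> Y" "ennreal Y = (\<integral>\<^sup>+v\<in>{0..}. (\<integral>\<^sup>+u\<in>{0..}.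
      ennreal (dpow (2 * j) v * dpow (2 * m) u * ((cosh u + cosh v) / (1 + cosh u * cosh v)\<^sup>2)) \<partial>lborel) \<partial>lborel)"
proof -
  define G where "G = (\<lambda>i v. kern (2 * i) (2 * j) 0 v * indicator {0..} v)"
  have "has_bochner_integral lborel (G i) (wfun (2 * i + 1) (2 * j) 0)" for i
  proof (rule has_bochner_integral_nn_integral)
    show "G i \<in> borel_measurable lborel" unfolding G_def by measurable
    show "AE v in lborel. 0 \<le> G i v" by (auto simp: G_def indicator_def kern_nonneg)
    have "(\<integral>\<^sup>+v. ennreal (G i v) \<partial>lborel) = kint (2 * i) (2 * j) 0"
      unfolding kint_def G_def by (intro nn_integral_cong) (auto simp: indicator_def)
    then show "(\<integral>\<^sup>+v. ennreal (G i v) \<partial>lborel) = ennreal (wfun (2 * i + 1) (2 * j) 0)"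
      "0 \<le> wfun (2 * i + 1) (2 * j) 0"
      using wfun_0_eq_kint[of "2 * i" "2 * j"] by auto
  qed
  then have "has_bochner_integral lborel (\<lambda>v. \<Sum>i\<le>m. zcoef (m - i) * ((-1) ^ i * G i v)) Y"
    unfolding Y_def by (intro has_bochner_integral_sum has_bochner_integral_mult_right)
  also have "(\<lambda>v. \<Sum>i\<le>m. zcoef (m - i) * ((-1) ^ i * G i v))
      = (\<lambda>v. dpow (2 * j) v / cosh v * angle_poly m (gd v) * indicator {0..} v)"
  proof -
    have "a * (b * (c * e / C * i)) = c / C * (a * (b * e)) * i" for a b c e i C :: real
      by (simp add: mult_ac)
    then show ?thesis
      unfolding angle_poly_def sum_distrib_left sum_distrib_right
      by (intro ext sum.cong refl) (simp only: G_def kern_def gd_0 diff_zero dpow_def[symmetric])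
  qed
  finally have hb: "has_bochner_integral lborel
      (\<lambda>v. dpow (2 * j) v / cosh v * angle_poly m (gd v) * indicator {0..} v) Y" .
  have gp: "0 \<le> angle_poly m (gd v)" "gmom m (gd v) = ennreal (angle_poly m (gd v))" if "0 \<le> v" for v
    using gmom_eq_angle_poly[of "gd v" m] gd_nonneg[OF that] gd_less_pi_half[of v] by auto
  have nonneg: "0 \<le> dpow (2 * j) v / cosh v * angle_poly m (gd v) * indicator {0..} v" for v
    using gp(1)[of v] dpow_nonneg[of v "2 * j"] by (cases "0 \<le> v") simp_all
  show "0 \<le> Y"
    unfolding has_bochner_integral_integral_eq[OF hb, symmetric] by (intro integral_nonneg_AE AE_I2 nonneg)
  have "ennreal Y = (\<integral>\<^sup>+v. ennreal (dpow (2 * j) v / cosh v * angle_poly m (gd v) * indicator {0..} v) \<partial>lborel)"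
    using nn_integral_eq_integral[OF integrable.intros[OF hb] AE_I2[OF nonneg]]
    by (simp only: has_bochner_integral_integral_eq[OF hb])
  also have "\<dots> = (\<integral>\<^sup>+v\<in>{0..}. (\<integral>\<^sup>+u\<in>{0..}.
      ennreal (dpow (2 * j) v * dpow (2 * m) u * ((cosh u + cosh v) / (1 + cosh u * cosh v)\<^sup>2)) \<partial>lborel) \<partial>lborel)"
  proof (rule nn_integral_cong)
    fix v :: real
    have "ennreal (dpow (2 * j) v / cosh v * angle_poly m (gd v)) = (\<integral>\<^sup>+u\<in>{0..}.
        ennreal (dpow (2 * j) v * dpow (2 * m) u * ((cosh u + cosh v) / (1 + cosh u * cosh v)\<^sup>2)) \<partial>lborel)"
      if v: "0 \<le> v"
    proof -
      have c: "0 \<le> cos (gd v)" by (simp add: cos_gd)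
      have "ennreal (dpow (2 * j) v / cosh v * angle_poly m (gd v)) = ennreal (dpow (2 * j) v / cosh v) * gmom m (gd v)"
        unfolding gp(2)[OF v] using v gp(1)[OF v] by (intro ennreal_mult) (auto simp: dpow_nonneg)
      also have "\<dots> = (\<integral>\<^sup>+u. ennreal (dpow (2 * j) v / cosh v) *
          (ennreal (u ^ (2 * m) / fact (2 * m)) * ennreal (gker (gd v) u) * indicator {0..} u) \<partial>lborel)"
        unfolding gmom_def mom_def by (rule nn_integral_cmult[symmetric]) measurable
      also have "\<dots> = (\<integral>\<^sup>+u\<in>{0..}. ennreal (dpow (2 * j) v * dpow (2 * m) u *
          ((cosh u + cosh v) / (1 + cosh u * cosh v)\<^sup>2)) \<partial>lborel)"
      proof (rule nn_integral_cong)
        fix u :: real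
        have "ennreal (dpow (2 * j) v / cosh v) * (ennreal (dpow (2 * m) u) * ennreal (gker (gd v) u))
            = ennreal (dpow (2 * j) v / cosh v * (dpow (2 * m) u * gker (gd v) u))" if "0 \<le> u"
          using that v c by (subst ennreal_mult, simp_all add: dpow_nonneg gker_nonneg ennreal_mult)
        \<comment> \<open>The factor \<open>1 / cosh v\<close> is moved to \<open>gker\<close>,
          where \<open>gker_gd\<close> makes the kernel symmetric.\<close>
        moreover have "dpow (2 * j) v / cosh v * (dpow (2 * m) u * gker (gd v) u)
            = dpow (2 * j) v * dpow (2 * m) u * (gker (gd v) u / cosh v)"
          by simp
        ultimately show "ennreal (dpow (2 * j) v / cosh v) *
            (ennreal (u ^ (2 * m) / fact (2 * m)) * ennreal (gker (gd v) u) * indicator {0..} u)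
          = ennreal (dpow (2 * j) v * dpow (2 * m) u * ((cosh u + cosh v) / (1 + cosh u * cosh v)\<^sup>2)) * indicator {0..} u"
          unfolding gker_gd by (auto simp: indicator_def dpow_def)
      qed
      finally show ?thesis .
    qed
    then show "ennreal (dpow (2 * j) v / cosh v * angle_poly m (gd v) * indicator {0..} v)
      = (\<integral>\<^sup>+u\<in>{0..}. ennreal (dpow (2 * j) v * dpow (2 * m) u *
          ((cosh u + cosh v) / (1 + cosh u * cosh v)\<^sup>2)) \<partial>lborel) * indicator {0..} v"
      by (auto simp: indicator_def)
  qed
  finally show "ennreal Y = (\<integral>\<^sup>+v\<in>{0..}. (\<integral>\<^sup>+u\<in>{0..}.
      ennreal (dpow (2 * j) v * dpow (2 * m) u * ((cosh u + cosh v) / (1 + cosh u * cosh v)\<^sup>2)) \<partial>lborel) \<partial>lborel)" .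
qed

text \<open>Exchanging the order of integration swaps the roles of \<open>m\<close> and
  \<open>j\<close>; nonnegativity of both sides allows \<open>ennreal\<close> to be removed.\<close>

lemma zcoef_wfun_symmetric:
  "(\<Sum>i\<le>m. zcoef (m - i) * ((-1) ^ i * wfun (2 * i + 1) (2 * j) 0))
    = (\<Sum>i\<le>j. zcoef (j - i) * ((-1) ^ i * wfun (2 * i + 1) (2 * m) 0))"
proof -
  have "ennreal (\<Sum>i\<le>m. zcoef (m - i) * ((-1) ^ i * wfun (2 * i + 1) (2 * j) 0))
      = (\<integral>\<^sup>+u\<in>{0..}. (\<integral>\<^sup>+v\<in>{0..}. ennreal (dpow (2 * j) v * dpow (2 * m) u *
          ((cosh u + cosh v) / (1 + cosh u * cosh v)\<^sup>2)) \<partial>lborel) \<partial>lborel)"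
    unfolding zcoef_wfun_integral(2)
    by (rule nn_integral_rectangle[where f = "\<lambda>v u. ennreal (dpow (2 * j) v * dpow (2 * m) u *
          ((cosh u + cosh v) / (1 + cosh u * cosh v)\<^sup>2))"]) measurable
  also have "\<dots> = ennreal (\<Sum>i\<le>j. zcoef (j - i) * ((-1) ^ i * wfun (2 * i + 1) (2 * m) 0))"
    unfolding zcoef_wfun_integral(2) by (simp add: mult_ac add_ac)
  finally show ?thesis
    using zcoef_wfun_integral(1) by (subst (asm) ennreal_inj) auto
qed

theorem theorem1p2:
  fixes m p :: nat
  assumes "0 < m" and "0 < p"
  shows "(-1) ^ m * (\<Sum>j=1..p. W (2*j + 2*m - 3) (2*m - 1) * Z j p)
       = (-1) ^ p * (\<Sum>j=1..m. W (2*j + 2*p - 3) (2*p - 1) * Z j m)"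
proof -
  define X where "X = (\<lambda>i j. (-1) ^ i * wfun (2 * i + 1) (2 * j) 0)"
  \<comment> \<open>With \<open>m\<close>, \<open>p\<close> and \<open>j\<close> lowered by one, the
    weight is \<open>(2*m + 1) + 2*j\<close> at depth \<open>2*m + 1\<close>. The odd depth gives a
    sign -1, so \<open>(-1) ^ Suc m\<close> turns into the \<open>(-1) ^ m\<close> in
    \<open>X\<close>.\<close>
  have side: "(-1) ^ Suc m * (\<Sum>j=1..Suc p. W (2*j + 2*Suc m - 3) (2*Suc m - 1) * Z j (Suc p))
      = (\<Sum>j\<le>p. X m j * fps_nth (inverse zfps) (p - j))" for m p
  proof -
    have "(\<Sum>j=1..Suc p. W (2*j + 2*Suc m - 3) (2*Suc m - 1) * Z j (Suc p))
        = (\<Sum>j\<le>p. W (2*Suc j + 2*Suc m - 3) (2*Suc m - 1) * Z (Suc j) (Suc p))"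
      by (rule sum.reindex_bij_witness[of _ Suc "\<lambda>j. j - 1"]) auto
    also have "\<dots> = (\<Sum>j\<le>p. W ((2*m + 1) + 2*j) (2*m + 1) * fps_nth (inverse zfps) (p - j))"
      by (intro sum.cong refl) (simp add: Z_eq_inverse_zfps algebra_simps)
    also have "\<dots> = (\<Sum>j\<le>p. - wfun (2*m + 1) (2*j) 0 * fps_nth (inverse zfps) (p - j))"
      by (subst W_eq_wfun) auto
    finally show ?thesis by (simp add: X_def sum_distrib_left sum_negf mult_ac)
  qed
  have "(\<Sum>i\<le>a. zcoef (a - i) * X i b) = (\<Sum>i\<le>b. zcoef (b - i) * X i a)" for a b
    unfolding X_def by (rule zcoef_wfun_symmetric)
  then have "(\<Sum>j\<le>p - 1. X (m - 1) j * fps_nth (inverse zfps) (p - 1 - j))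
      = (\<Sum>j\<le>m - 1. X (p - 1) j * fps_nth (inverse zfps) (m - 1 - j))"
    by (rule inverse_toeplitz_symmetric)
  then show ?thesis
    using side[of "m - 1" "p - 1"] side[of "p - 1" "m - 1"] assms by simp
qed

end
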